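(* Let $\xi(-k,s)$ be a Lévy symbol, namely the symbol of the one-dimensional pseudo-differential operator $\Xi_{x,t}$, and let $\Xi_{\mathbf x,\mathbf t}=\mathcal{T}^{-1}\Xi_{x,t}\mathcal{T}$ be the associated directional operator on $\mathcal{A}_n$. Then $\Xi_{\mathbf x,\mathbf t}$ is a pseudo-differential operator with symbol $\xi\big(-\sum_{i=1}^nk_i,\sum_{i=1}^ns_i\big)$, i.e. $\overline{\Xi_{\mathbf x,\mathbf t}f}(\mathbf k,\mathbf s)=\xi\big(-\sum_{i=1}^nk_i,\sum_{i=1}^ns_i\big)\overline f(\mathbf k,\mathbf s)$ for all $f$ in its domain, and its domain is $$D(\Xi_{\mathbf x,\mathbf t})=\Big\{f\in\mathcal{A}_n:\ \exists h\in\mathcal{A}_n\ \text{ such that }\ \xi\Big(-\sum_{i=1}^nk_i,\sum_{i=1}^ns_i\Big)\overline f(\mathbf k,\mathbf s)=\overline h(\mathbf k,\mathbf s)\Big\}.$$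
   Context: Lévy symbol. $\xi$ is given by $E(e^{ikA_u-sD_u})=e^{u\xi(k,s)}$ for a Lévy process $(A_u,D_u)$ on $\mathbb{R}\times\mathbb{R}_+$ (so $D$ is a subordinator). One-dimensional operator. For $\omega>0$ let $L^1_\omega(\mathbb{R}\times\mathbb{R}_+)$ be the Banach space of measurable $f$ with $\int_{\mathbb{R}}\int_{\mathbb{R}_+}|f(x,t)|e^{-\omega t}\,dt\,dx<\infty$. The Fourier–Laplace transform is $\overline f(k,s)=\int\int e^{-ikx-st}f(x,t)\,dx\,dt$, $k\in\mathbb{R}$, $s>\omega$. By a known result, $\xi(-k,s)$ is the symbol of the generator $\Xi_{x,t}$ of a Feller semigroup on $L^1_\omega(\mathbb{R}\times\mathbb{R}_+)$, with domain $\{f:\exists h\in L^1_\omega,\ \xi(-k,s)\overline f(k,s)=\overline h(k,s)\}$ and $\Xi_{x,t}f=h$. Spaces. Fix $n\in\mathbb{N}$ and $\boldsymbol\omega\in\mathbb{R}_+^n$ with positive entries. $L^1_{\boldsymbol\omega}(\mathbb{R}^n\times\mathbb{R}^n)$ is the space of measurable $f(\mathbf x,\mathbf t)$ with $\int_{\mathbb{R}^n}\int_{\mathbb{R}^n}|f(\mathbf x,\mathbf t)|e^{-\langle\boldsymbol\omega,\mathbf t\rangle}\,d\mathbf x\,d\mathbf t<\infty$. Let $A^n=\{\mathbf t:0<t_1\le t_2\le\dots\le t_n<\infty\}$ and $B^n=\{\mathbf t:t_1>0,\ 0\le t_2\le\dots\le t_n\}$. $\mathcal{A}_n\subset L^1_{\boldsymbol\omega}(\mathbb{R}^n\times\mathbb{R}^n)$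 is the closed subspace of functions vanishing outside $\mathbb{R}^n\times A^n$. Let $\mathcal{T}$ be the invertible $n\times n$ matrix whose first column is $(1,\dots,1)^T$ and whose $i$-th column is the $i$-th standard basis vector for $1<i\le n$; it maps $B^n$ bijectively onto $A^n$ and has determinant $1$. $\mathcal{T}^*$ denotes its transpose. $\mathcal{B}_n\subset L^1_{\mathcal{T}^*\boldsymbol\omega}(\mathbb{R}^n\times\mathbb{R}^n)$ is the subspace of functions vanishing outside $\mathbb{R}^n\times B^n$. The operator $\mathcal{T}:\mathcal{A}_n\to\mathcal{B}_n$, $(\mathcal{T}f)(\mathbf x',\mathbf t')=f(\mathcal{T}\mathbf x',\mathcal{T}\mathbf t')$, is an isometric isomorphism. For $f\in\mathcal{A}_n$, the Fourier–Laplace transform $\overline f(\mathbf k,\mathbf s)=\int\int e^{-i\langle\mathbf k,\mathbf x\rangle-\langle\mathbf s,\mathbf t\rangle}f(\mathbf x,\mathbf t)\,d\mathbf x\,d\mathbf t$ is considered for $\mathbf k\in\mathbb{R}^n$ and $\mathbf s\in\hat A^n=\{\mathbf s:s_i>\omega_i\}$; for $f\in\mathcal{B}_n$ it is considered for $\mathbf s\in\mathcal{T}^*\hat A^n$. Operators. $\Xi_{x,t}$ acts on $\mathcal{B}_n$ in the first space variable and the first time variable only: $f\mapsto\Xi_{x,t}f(\cdot,x_2,\dots,x_n;\cdot,t_2,\dots,t_n)$, with the one-dimensional weight $\omega=\sum_i\omega_i$; its domain consists of those $f\in\mathcal{B}_n$ for which almost every slice is in the one-dimensional domain and the resulting function is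 in $\mathcal{B}_n$. Finally $\Xi_{\mathbf x,\mathbf t}=\mathcal{T}^{-1}\Xi_{x,t}\mathcal{T}$, with domain $\{f\in\mathcal{A}_n:\mathcal{T}f\in D(\Xi_{x,t})\}$. *)

theory Defs
  imports "HOL-Probability.Probability"
begin

(* Stochastic continuity is required instead of cadlag paths; a process in this sense always
   has a cadlag modification, with the same one-dimensional distributions. *)
locale levy_process = prob_space M for M :: "'a measure" +
  fixes X :: "real \<Rightarrow> 'a \<Rightarrow> real \<times> real"
  assumes measurable_X: "u \<ge> 0 \<Longrightarrow> random_variable borel (X u)"
    and starts_at_zero: "AE a in M. X 0 a = 0"
    and independent_increments:
      "\<lbrakk>0 \<le> \<tau> (0::nat); \<And>j. j < m \<Longrightarrow> \<tau> j \<le> \<tau> (Suc j)\<rbrakk>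
        \<Longrightarrow> indep_vars (\<lambda>_. borel) (\<lambda>j a. X (\<tau> (Suc j)) a - X (\<tau> j) a) {..<m}"
    and stationary_increments:
      "\<lbrakk>0 \<le> u; 0 \<le> v\<rbrakk> \<Longrightarrow> distr M borel (\<lambda>a. X (u + v) a - X u a) = distr M borel (X v)"
    and stochastically_continuous:
      "\<lbrakk>0 \<le> u; 0 < \<epsilon>\<rbrakk>
        \<Longrightarrow> ((\<lambda>v. prob {a \<in> space M. dist (X v a) (X u a) > \<epsilon>}) \<longlongrightarrow> 0) (at u within {0..})"

(* X = (A, D) with values in R x R_+, so that D is a subordinator. *)
locale levy_subordinator_process = levy_process +
  assumes second_nonneg: "u \<ge> 0 \<Longrightarrow> AE a in M. 0 \<le> snd (X u a)"

definition is_levy_symbol ::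
    "'a measure \<Rightarrow> (real \<Rightarrow> 'a \<Rightarrow> real \<times> real) \<Rightarrow> (real \<Rightarrow> real \<Rightarrow> complex) \<Rightarrow> bool" where
  "is_levy_symbol M X \<xi> \<longleftrightarrow>
     (\<forall>u\<ge>0. \<forall>k. \<forall>s\<ge>0.
        (LINT a|M. exp (\<i> * of_real (k * fst (X u a)) - of_real (s * snd (X u a))))
          = exp (of_real u * \<xi> k s))"


(* Elements of the L1 spaces are represented by Borel functions; functions that agree almost
   everywhere represent the same element, and the domains below respect this identification.
   Values of functions in L1_half outside R x R_+ are irrelevant. *)

definition L1_half :: "real \<Rightarrow> (real \<times> real \<Rightarrow> complex) set" where
  "L1_half w = {f. set_integrable lborel (UNIV \<times> {0..}) (\<lambda>(x, t). exp (- (w * t)) *\<^sub>R f (x, t))}"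

definition FL_half :: "(real \<times> real \<Rightarrow> complex) \<Rightarrow> real \<Rightarrow> real \<Rightarrow> complex" where
  "FL_half f k s =
     (LINT (x, t):UNIV \<times> {0..}|lborel. exp (- \<i> * of_real (k * x) - of_real (s * t)) * f (x, t))"

definition Xi_rel ::
    "(real \<Rightarrow> real \<Rightarrow> complex) \<Rightarrow> real \<Rightarrow> (real \<times> real \<Rightarrow> complex) \<Rightarrow> (real \<times> real \<Rightarrow> complex) \<Rightarrow> bool" where
  "Xi_rel \<xi> w f h \<longleftrightarrow>
     h \<in> L1_half w \<and> (\<forall>k. \<forall>s>w. \<xi> (- k) s * FL_half f k s = FL_half h k s)"

definition Xi_dom ::
    "(real \<Rightarrow> real \<Rightarrow> complex) \<Rightarrow> real \<Rightarrow> (real \<times> real \<Rightarrow> complex) set" where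
  "Xi_dom \<xi> w = {f \<in> L1_half w. \<exists>h. Xi_rel \<xi> w f h}"

(* The choice only selects a representative: by injectivity of the transform, h is unique up
   to null sets. *)
definition Xi ::
    "(real \<Rightarrow> real \<Rightarrow> complex) \<Rightarrow> real \<Rightarrow> (real \<times> real \<Rightarrow> complex) \<Rightarrow> (real \<times> real \<Rightarrow> complex)" where
  "Xi \<xi> w f = (SOME h. Xi_rel \<xi> w f h)"


(* Vectors of length n are indexed by an arbitrary finite linearly ordered type 'n with n
   elements; first is the index written 1 on paper. *)

type_synonym 'n spacetime_fun = "(real, 'n) vec \<times> (real, 'n) vec \<Rightarrow> complex"

definition first :: "'n::{finite,wellorder}" where
  "first = (LEAST i. True)"

definition L1 :: "real^'n \<Rightarrow> 'n spacetime_fun set" where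
  "L1 w = {f. integrable lborel (\<lambda>(x, t). exp (- (w \<bullet> t)) *\<^sub>R f (x, t))}"

definition FL :: "'n spacetime_fun \<Rightarrow> real^'n \<Rightarrow> real^'n \<Rightarrow> complex" where
  "FL f k s =
     (LINT (x, t)|lborel. exp (- \<i> * of_real (k \<bullet> x) - of_real (s \<bullet> t)) * f (x, t))"

definition A_cone :: "(real^'n::{finite,wellorder}) set" where
  "A_cone = {t. 0 < t $ first \<and> (\<forall>i j. i \<le> j \<longrightarrow> t $ i \<le> t $ j)}"

definition B_cone :: "(real^'n::{finite,wellorder}) set" where
  "B_cone = {t. 0 < t $ first \<and> (\<forall>i. i \<noteq> first \<longrightarrow> 0 \<le> t $ i)
                 \<and> (\<forall>i j. i \<noteq> first \<and> i \<le> j \<longrightarrow> t $ i \<le> t $ j)}"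

definition T_mat :: "real^('n::{finite,wellorder})^('n::{finite,wellorder})" where
  "T_mat = (\<chi> i j. if j = first \<or> i = j then 1 else 0)"

definition A_space :: "real^'n::{finite,wellorder} \<Rightarrow> 'n spacetime_fun set" where
  "A_space \<omega> = {f \<in> L1 \<omega>. AE (x, t) in lborel. t \<notin> A_cone \<longrightarrow> f (x, t) = 0}"

definition B_space :: "real^'n::{finite,wellorder} \<Rightarrow> 'n spacetime_fun set" where
  "B_space \<omega> = {f \<in> L1 (transpose T_mat *v \<omega>). AE (x, t) in lborel. t \<notin> B_cone \<longrightarrow> f (x, t) = 0}"

definition T_op :: "'n::{finite,wellorder} spacetime_fun \<Rightarrow> 'n spacetime_fun" where
  "T_op f = (\<lambda>(x, t). f (T_mat *v x, T_mat *v t))"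

definition T_inv_op :: "'n::{finite,wellorder} spacetime_fun \<Rightarrow> 'n spacetime_fun" where
  "T_inv_op f = (\<lambda>(x, t). f (matrix_inv T_mat *v x, matrix_inv T_mat *v t))"

(* slice f y r is the function of the first space and time variable obtained by freezing the
   others at y and r, which are functions on the indices different from first. *)

definition insert_first :: "real \<Rightarrow> ('n \<Rightarrow> real) \<Rightarrow> real^'n::{finite,wellorder}" where
  "insert_first a y = (\<chi> i. if i = first then a else y i)"

definition slice ::
    "'n::{finite,wellorder} spacetime_fun \<Rightarrow> ('n \<Rightarrow> real) \<Rightarrow> ('n \<Rightarrow> real) \<Rightarrow> (real \<times> real \<Rightarrow> complex)" where
  "slice f y r = (\<lambda>(a, b). f (insert_first a y, insert_first b r))"

definition rest_lborel :: "('n::{finite,wellorder} \<Rightarrow> real) measure" where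
  "rest_lborel = PiM (UNIV - {first}) (\<lambda>_. lborel)"

definition Xi_B_rel ::
    "(real \<Rightarrow> real \<Rightarrow> complex) \<Rightarrow> real^'n::{finite,wellorder} \<Rightarrow> 'n spacetime_fun \<Rightarrow> 'n spacetime_fun \<Rightarrow> bool" where
  "Xi_B_rel \<xi> \<omega> f h \<longleftrightarrow>
     h \<in> B_space \<omega> \<and>
     (AE (y, r) in rest_lborel \<Otimes>\<^sub>M rest_lborel.
        slice f y r \<in> Xi_dom \<xi> (\<Sum>i\<in>UNIV. \<omega> $ i) \<and>
        (AE (a, b) in lborel. b \<ge> 0 \<longrightarrow> slice h y r (a, b) = Xi \<xi> (\<Sum>i\<in>UNIV. \<omega> $ i) (slice f y r) (a, b)))"

definition Xi_B_dom ::
    "(real \<Rightarrow> real \<Rightarrow> complex) \<Rightarrow> real^'n::{finite,wellorder} \<Rightarrow> 'n spacetime_fun set" where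
  "Xi_B_dom \<xi> \<omega> = {f \<in> B_space \<omega>. \<exists>h. Xi_B_rel \<xi> \<omega> f h}"

(* Again the choice only selects a representative: almost every slice of h is determined up to
   null sets, hence so is h. *)
definition Xi_B ::
    "(real \<Rightarrow> real \<Rightarrow> complex) \<Rightarrow> real^'n::{finite,wellorder} \<Rightarrow> 'n spacetime_fun \<Rightarrow> 'n spacetime_fun" where
  "Xi_B \<xi> \<omega> f = (SOME h. Xi_B_rel \<xi> \<omega> f h)"

definition Xi_A_dom ::
    "(real \<Rightarrow> real \<Rightarrow> complex) \<Rightarrow> real^'n::{finite,wellorder} \<Rightarrow> 'n spacetime_fun set" where
  "Xi_A_dom \<xi> \<omega> = {f \<in> A_space \<omega>. T_op f \<in> Xi_B_dom \<xi> \<omega>}"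

definition Xi_A ::
    "(real \<Rightarrow> real \<Rightarrow> complex) \<Rightarrow> real^'n::{finite,wellorder} \<Rightarrow> 'n spacetime_fun \<Rightarrow> 'n spacetime_fun" where
  "Xi_A \<xi> \<omega> f = T_inv_op (Xi_B \<xi> \<omega> (T_op f))"

definition A_hat :: "real^'n \<Rightarrow> (real^'n) set" where
  "A_hat \<omega> = {s. \<forall>i. s $ i > \<omega> $ i}"

end

theory Submission
  imports Defs "HOL-Complex_Analysis.Conformal_Mappings" "HOL-Real_Asymp.Real_Asymp"
begin

text \<open>The change of variables by the unimodular matrix T turns the factor
  \<open>\<xi> (- (k\<^sub>1 + \<dots> + k\<^sub>n)) (s\<^sub>1 + \<dots> + s\<^sub>n)\<close> into \<open>\<xi> (- k\<^sub>1) s\<^sub>1\<close>,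
  so it suffices to treat functions supported on the cone B. There Fubini writes the full transform as the transform, in
  the frozen variables, of the one-dimensional transforms of the slices. If slicewise the operator
  acts as multiplication by the symbol, so does it globally. Conversely, fix
  \<open>k\<^sub>1\<close> and \<open>s\<^sub>1\<close>: the frozen-variable transform of
  \<open>\<xi> (- k\<^sub>1) s\<^sub>1 FL g - FL h\<close> vanishes for all frozen \<open>k\<close>, but only for frozen \<open>s\<close> in
  a bounded box, since the transformed region is \<open>s\<^sub>1 > \<omega>\<^sub>1 + s\<^sub>2 + \<dots> + s\<^sub>n\<close>. Analyticity
  of the Laplace transform makes such a box sufficient for injectivity, so almost every slice satisfies
  the one-dimensional equation at all rational \<open>(k\<^sub>1, s\<^sub>1)\<close>, hence everywhere by continuity of
  \<open>\<xi>\<close>.\<close>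

section \<open>Families of functions that determine integrable functions\<close>

text \<open>Two inputs are weak: \<open>Xi\<close> returns an arbitrary representative, and \<xi> is
  known only through exp (u \<xi>). Injectivity of the half-plane transform must therefore identify
  a slice of h with the representative that \<open>Xi\<close> picks, and continuity of \<xi> must be
  derived from the process before rational frequencies can stand for all of them. Each frequency
  pair has its own exceptional null set of slices, hence the insistence on countable families. The
  weight is absorbed into the function before testing, so that the remaining kernels have norm at
  most 1 on the support.\<close>

text \<open>Only functions supported on \<open>S\<close> are tested, so that the kernels \<open>exp (- \<sigma> t)\<close>
  need to be bounded on the half line only.\<close>

definition determining :: "'a measure \<Rightarrow> 'a set \<Rightarrow> ('a \<Rightarrow> complex) set \<Rightarrow> bool" where
  "determining M S E \<longleftrightarrow>
     (\<forall>e\<in>E. e \<in> borel_measurable M \<and> (\<forall>x\<in>space M \<inter> S. norm (e x) \<le> 1)) \<and>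
     (\<forall>F. integrable M F \<longrightarrow> (\<forall>x. x \<notin> S \<longrightarrow> F x = 0) \<longrightarrow> (\<forall>e\<in>E. (LINT x|M. e x * F x) = 0)
        \<longrightarrow> (AE x in M. F x = 0))"

lemma determiningD:
  assumes "determining M S E" "integrable M F" "\<And>x. x \<notin> S \<Longrightarrow> F x = 0"
    "\<And>e. e \<in> E \<Longrightarrow> (LINT x|M. e x * F x) = 0"
  shows "AE x in M. F x = 0"
  using assms unfolding determining_def by blast

lemma integrable_mult_supported:
  fixes e F :: "'a \<Rightarrow> complex"
  assumes "integrable M F" "e \<in> borel_measurable M"
    and "\<And>x. x \<in> space M \<Longrightarrow> x \<notin> S \<Longrightarrow> F x = 0"
    and "\<And>x. x \<in> space M \<Longrightarrow> x \<in> S \<Longrightarrow> norm (e x) \<le> 1"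
  shows "integrable M (\<lambda>x. e x * F x)"
proof (rule Bochner_Integration.integrable_bound[OF assms(1)])
  show "(\<lambda>x. e x * F x) \<in> borel_measurable M" using assms by measurable
  have "norm (e x * F x) \<le> norm (F x)" if "x \<in> space M" for x
    using assms(3,4)[OF that] by (cases "x \<in> S") (auto simp: norm_mult mult_left_le_one_le)
  thus "AE x in M. norm (e x * F x) \<le> norm (F x)" by auto
qed

text \<open>Countability of \<open>E\<close> is what allows the exceptional null sets of the sections, one for each
  element of \<open>E\<close>, to be united.\<close>

lemma determining_pair:
  assumes M: "sigma_finite_measure M" and N: "sigma_finite_measure N" and cE: "countable E"
    and dM: "determining M S E" and dN: "determining N S' E'"
  shows "determining (M \<Otimes>\<^sub>M N) (S \<times> S') ((\<lambda>(e, e') (x, y). e x * e' y) ` (E \<times> E'))"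
  unfolding determining_def
proof (intro conjI allI impI ballI)
  interpret M: sigma_finite_measure M by fact
  interpret N: sigma_finite_measure N by fact
  interpret pair_sigma_finite M N ..
  have E: "e \<in> borel_measurable M" "\<And>x. x \<in> space M \<Longrightarrow> x \<in> S \<Longrightarrow> norm (e x) \<le> 1" if "e \<in> E" for e
    using dM that unfolding determining_def by auto
  have E': "e \<in> borel_measurable N" "\<And>x. x \<in> space N \<Longrightarrow> x \<in> S' \<Longrightarrow> norm (e x) \<le> 1" if "e \<in> E'" for e
    using dN that unfolding determining_def by auto
  {
    fix g assume "g \<in> (\<lambda>(e, e') (x, y). e x * e' y) ` (E \<times> E')"
    then obtain e e' where g: "e \<in> E" "e' \<in> E'" "g = (\<lambda>(x, y). e x * e' y)" by auto
    note [measurable] = E(1)[OF g(1)] E'(1)[OF g(2)]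
    show "g \<in> borel_measurable (M \<Otimes>\<^sub>M N)" unfolding g by measurable
    fix z assume "z \<in> space (M \<Otimes>\<^sub>M N) \<inter> S \<times> S'"
    then show "norm (g z) \<le> 1" using E(2)[OF g(1)] E'(2)[OF g(2)]
      by (auto simp: g norm_mult space_pair_measure intro!: mult_le_one)
  }
  fix F assume F: "integrable (M \<Otimes>\<^sub>M N) F" and F0: "\<forall>z. z \<notin> S \<times> S' \<longrightarrow> F z = 0"
    and I: "\<forall>g\<in>(\<lambda>(e, e') (x, y). e x * e' y) ` (E \<times> E'). (LINT z|(M \<Otimes>\<^sub>M N). g z * F z) = 0"
  have [measurable]: "F \<in> borel_measurable (M \<Otimes>\<^sub>M N)" using F by auto
  have "AE y in N. \<forall>e\<in>E. (LINT x|M. e x * F (x, y)) = 0"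
    unfolding AE_ball_countable[OF cE]
  proof
    fix e assume e: "e \<in> E"
    note [measurable] = E(1)[OF e]
    have ie: "integrable (M \<Otimes>\<^sub>M N) (\<lambda>(x, y). e x * F (x, y))"
      using integrable_mult_supported[OF F, of "\<lambda>z. e (fst z)" "S \<times> S'"] F0 E(2)[OF e]
      by (auto simp: space_pair_measure case_prod_beta')
    \<comment> \<open>For fixed \<open>e\<close> the partial integral is a function on
      \<open>N\<close> that can be tested by \<open>E'\<close>; Fubini reduces this test to the
      hypothesis on products.\<close>
    show "AE y in N. (LINT x|M. e x * F (x, y)) = 0"
    proof (rule determiningD[OF dN])
      show "integrable N (\<lambda>y. LINT x|M. e x * F (x, y))"
        by (rule integrable_snd[OF ie])
      show "(LINT x|M. e x * F (x, y)) = 0" if "y \<notin> S'" for y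
        using F0 that by simp
      fix e' assume e': "e' \<in> E'"
      note [measurable] = E'(1)[OF e']
      have iee: "integrable (M \<Otimes>\<^sub>M N) (\<lambda>(x, y). e' y * (e x * F (x, y)))"
        using integrable_mult_supported[OF ie, of "\<lambda>z. e' (snd z)" "S \<times> S'"] F0 E'(2)[OF e']
        by (auto simp: space_pair_measure case_prod_beta')
      have "(LINT y|N. e' y * (LINT x|M. e x * F (x, y))) = (LINT y|N. LINT x|M. e' y * (e x * F (x, y)))"
        by simp
      also have "\<dots> = (LINT z|(M \<Otimes>\<^sub>M N). (\<lambda>(x, y). e' y * (e x * F (x, y))) z)"
        by (rule integral_snd[OF iee])
      also have "\<dots> = (LINT z|(M \<Otimes>\<^sub>M N). (\<lambda>(x, y). e x * e' y) z * F z)"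
        by (intro Bochner_Integration.integral_cong) auto
      also have "\<dots> = 0" using I e e' by (auto simp: image_iff)
      finally show "(LINT y|N. e' y * (LINT x|M. e x * F (x, y))) = 0" .
    qed
  qed
  moreover have "AE y in N. integrable M (\<lambda>x. F (x, y))"
    by (rule AE_integrable_snd) (use F in simp)
  ultimately have "AE y in N. AE x in M. F (x, y) = 0"
  proof eventually_elim
    case (elim y)
    show ?case by (rule determiningD[OF dM]) (use elim F0 in auto)
  qed
  then have "AE x in M. AE y in N. F (x, y) = 0"
    by (subst AE_commute) auto
  then show "AE z in M \<Otimes>\<^sub>M N. F z = 0"
    by (intro AE_pair_measure) auto
qed

text \<open>Lets an induction over the index set work with binary products. A finite product measure
  is determined by its values on rectangles, and the preimage of a rectangle is again a
  rectangle.\<close>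

lemma (in product_sigma_finite) distr_fun_upd_PiM:
  assumes I: "finite I" "i \<notin> I"
  shows "distr (PiM I M \<Otimes>\<^sub>M M i) (PiM (insert i I) M) (\<lambda>(X, x). X(i := x)) = PiM (insert i I) M"
proof (rule PiM_eqI)
  interpret I: finite_product_sigma_finite M I by standard fact
  fix A assume A: "\<And>j. j \<in> insert i I \<Longrightarrow> A j \<in> sets (M j)"
  have "(\<lambda>(X, x). X(i := x)) -` (Pi\<^sub>E (insert i I) A) \<inter> space (PiM I M \<Otimes>\<^sub>M M i) = Pi\<^sub>E I A \<times> A i"
    using I A[THEN sets.sets_into_space]
    by (auto simp: space_pair_measure space_PiM PiE_iff extensional_def split: if_splits)
  moreover have "Pi\<^sub>E I A \<in> sets (PiM I M)" using I A by (intro sets_PiM_I_finite) auto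
  ultimately show "emeasure (distr (PiM I M \<Otimes>\<^sub>M M i) (PiM (insert i I) M) (\<lambda>(X, x). X(i := x)))
      (Pi\<^sub>E (insert i I) A) = (\<Prod>j\<in>insert i I. emeasure (M j) (A j))"
    using I A by (subst emeasure_distr)
      (auto simp: sigma_finite_measure.emeasure_pair_measure_Times[OF sigma_finite_measures]
         emeasure_PiM mult.commute intro!: sets_PiM_I_finite)
qed (use I in auto)

lemma determining_PiM:
  assumes M: "sigma_finite_measure M" and cE: "countable E" and d: "determining M S E" and "finite I"
  shows "determining (PiM I (\<lambda>_. M)) {x. \<forall>i\<in>I. x i \<in> S}
    ((\<lambda>e x. \<Prod>i\<in>I. e i (x i)) ` (I \<rightarrow>\<^sub>E E))"
  using \<open>finite I\<close>
proof (induction I rule: finite_induct)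
  \<comment> \<open>The empty product is a one-point space with counting measure, and the only test
    function is the constant 1, so a vanishing integral is a vanishing value.\<close>
  case empty
  show ?case
  proof (unfold determining_def, intro conjI allI impI ballI)
    fix F assume "\<forall>e\<in>(\<lambda>e x. \<Prod>i\<in>{}. e i (x i)) ` ({} \<rightarrow>\<^sub>E E). (LINT x|PiM {} (\<lambda>_. M). e x * F x) = 0"
    then have "(LINT x|PiM {} (\<lambda>_. M). F x) = 0" by auto
    then have "F (\<lambda>_. undefined) = 0"
      by (simp add: PiM_empty lebesgue_integral_count_space_finite)
    then show "AE x in PiM {} (\<lambda>_. M). F x = 0"
      unfolding PiM_empty by (subst AE_count_space) simp
  qed auto
next
  case (insert i I)
  interpret product_sigma_finite "\<lambda>_. M" using M by (simp add: product_sigma_finite_def)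
  interpret I: finite_product_sigma_finite "\<lambda>_. M" I by standard fact
  have d': "determining (PiM I (\<lambda>_. M) \<Otimes>\<^sub>M M) ({x. \<forall>i\<in>I. x i \<in> S} \<times> S)
     ((\<lambda>(e, e') (x, y). e x * e' y) ` ((\<lambda>e x. \<Prod>i\<in>I. e i (x i)) ` (I \<rightarrow>\<^sub>E E) \<times> E))"
  \<comment> \<open>The induction hypothesis fills the first factor, whose family has to be
    countable; it is, because a finite index set admits only countably many choices from
    \<open>E\<close>.\<close>
  proof (rule determining_pair[OF _ M _ insert.IH d])
    show "sigma_finite_measure (PiM I (\<lambda>_. M))" by (rule I.sigma_finite_measure_axioms)
    show "countable ((\<lambda>e x. \<Prod>i\<in>I. e i (x i)) ` (I \<rightarrow>\<^sub>E E))"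
      by (rule countable_image, rule countable_PiE) (use insert.hyps cE in auto)
  qed
  let ?\<phi> = "\<lambda>(X, x). X(i := x)"
  have distr: "distr (PiM I (\<lambda>_. M) \<Otimes>\<^sub>M M) (PiM (insert i I) (\<lambda>_. M)) ?\<phi> = PiM (insert i I) (\<lambda>_. M)"
    by (rule distr_fun_upd_PiM) (use insert.hyps in auto)
  have E: "e \<in> borel_measurable M" "\<And>x. x \<in> space M \<Longrightarrow> x \<in> S \<Longrightarrow> norm (e x) \<le> 1" if "e \<in> E" for e
    using d that unfolding determining_def by auto
  have phi[measurable]: "?\<phi> \<in> PiM I (\<lambda>_. M) \<Otimes>\<^sub>M M \<rightarrow>\<^sub>M PiM (insert i I) (\<lambda>_. M)" by measurable
  have prod_meas: "(\<lambda>x. \<Prod>j\<in>insert i I. e j (x j)) \<in> borel_measurable (PiM (insert i I) (\<lambda>_. M))"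
    if "e \<in> insert i I \<rightarrow>\<^sub>E E" for e
  proof (intro borel_measurable_prod)
    fix j assume "j \<in> insert i I"
    then show "(\<lambda>x. e j (x j)) \<in> borel_measurable (PiM (insert i I) (\<lambda>_. M))"
      using that E(1)[of "e j"] by (intro measurable_compose[OF measurable_component_singleton]) auto
  qed
  show ?case
  proof (unfold determining_def, intro conjI allI impI ballI; (elim imageE)?)
    fix g e assume e: "e \<in> insert i I \<rightarrow>\<^sub>E E" and g: "g = (\<lambda>x. \<Prod>i\<in>insert i I. e i (x i))"
    show "g \<in> borel_measurable (PiM (insert i I) (\<lambda>_. M))" unfolding g by (rule prod_meas[OF e])
    fix x assume "x \<in> space (PiM (insert i I) (\<lambda>_. M)) \<inter> {x. \<forall>i\<in>insert i I. x i \<in> S}"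
    then show "norm (g x) \<le> 1" using e E(2) unfolding g
      by (auto simp: prod_norm[symmetric] space_PiM PiE_iff simp del: prod.insert intro!: prod_le_1)
  next
    fix F assume F: "integrable (PiM (insert i I) (\<lambda>_. M)) F"
      and F0: "\<forall>x. x \<notin> {x. \<forall>i\<in>insert i I. x i \<in> S} \<longrightarrow> F x = 0"
      and I: "\<forall>g\<in>(\<lambda>e x. \<Prod>i\<in>insert i I. e i (x i)) ` (insert i I \<rightarrow>\<^sub>E E).
                (LINT x|PiM (insert i I) (\<lambda>_. M). g x * F x) = 0"
    note [measurable] = borel_measurable_integrable[OF F]
    have "AE z in PiM I (\<lambda>_. M) \<Otimes>\<^sub>M M. F (?\<phi> z) = 0"
    proof (rule determiningD[OF d'])
      show "integrable (PiM I (\<lambda>_. M) \<Otimes>\<^sub>M M) (\<lambda>z. F (?\<phi> z))"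
        by (rule integrable_distr[OF phi]) (simp add: distr F)
      show "F (?\<phi> z) = 0" if "z \<notin> {x. \<forall>i\<in>I. x i \<in> S} \<times> S" for z
        
      proof -
        obtain X x where z: "z = (X, x)" by fastforce
        consider "x \<notin> S" | j where "j \<in> I" "X j \<notin> S" using \<open>z \<notin> _\<close> z by auto
        then have "\<exists>j\<in>insert i I. (X(i := x)) j \<notin> S"
        proof cases
          case 1 then show ?thesis by auto
        next
          case (2 j)
          then show ?thesis using insert.hyps(2) by (intro bexI[of _ j]) auto
        qed
        then show ?thesis using F0 z by simp
      qed
    next
      fix g assume "g \<in> (\<lambda>(e, e') (x, y). e x * e' y) ` ((\<lambda>e x. \<Prod>i\<in>I. e i (x i)) ` (I \<rightarrow>\<^sub>E E) \<times> E)"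
      then obtain e e' where e: "e \<in> I \<rightarrow>\<^sub>E E" "e' \<in> E" and g: "g = (\<lambda>(x, y). (\<Prod>i\<in>I. e i (x i)) * e' y)"
        by auto
      let ?e = "e(i := e')"
      have e'': "?e \<in> insert i I \<rightarrow>\<^sub>E E" using e by (auto simp: PiE_iff extensional_def)
      note [measurable] = prod_meas[OF e'']
      have "0 = (LINT x|PiM (insert i I) (\<lambda>_. M). (\<Prod>j\<in>insert i I. ?e j (x j)) * F x)"
        using bspec[OF I imageI[OF e'']] by (rule sym)
      also have "\<dots> = (LINT z|(PiM I (\<lambda>_. M) \<Otimes>\<^sub>M M). (\<Prod>j\<in>insert i I. ?e j (?\<phi> z j)) * F (?\<phi> z))"
        by (subst distr[symmetric], subst integral_distr[OF phi])
          (auto intro!: borel_measurable_times prod_meas[OF e''] borel_measurable_integrable[OF F] simp del: prod.insert fun_upd_apply)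
      also have "\<dots> = (LINT z|(PiM I (\<lambda>_. M) \<Otimes>\<^sub>M M). g z * F (?\<phi> z))"
      proof (intro Bochner_Integration.integral_cong refl)
        fix z
        have "(\<Prod>j\<in>I. ?e j (?\<phi> z j)) = (\<Prod>j\<in>I. e j (fst z j))"
          using insert(2) by (intro prod.cong) (auto split: prod.splits)
        then show "(\<Prod>j\<in>insert i I. ?e j (?\<phi> z j)) * F (?\<phi> z) = g z * F (?\<phi> z)"
          using insert by (auto simp: g case_prod_beta')
      qed
      finally show "(LINT z|(PiM I (\<lambda>_. M) \<Otimes>\<^sub>M M). g z * F (?\<phi> z)) = 0" by simp
    qed
    then show "AE x in PiM (insert i I) (\<lambda>_. M). F x = 0"
      by (subst distr[symmetric], subst AE_distr_iff[OF phi]) auto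
  qed
qed

section \<open>Uniqueness of the Fourier transform on the line\<close>

lemma rational_approximation:
  fixes x :: real
  obtains X where "\<And>n. X n \<in> \<rat>" "\<And>n. x < X n" "X \<longlonglongrightarrow> x"
proof -
  \<comment> \<open>Strictness matters twice: approximants of an admissible Laplace frequency stay
    in the admissible half line, and they differ from their limit, as a limit point
    requires.\<close>
  have "\<exists>q\<in>\<rat>. x < q \<and> q < x + 1 / real (Suc n)" for n
    using Rats_dense_in_real[of x "x + 1 / real (Suc n)"] by auto
  then obtain X where X: "\<And>n. X n \<in> \<rat>" "\<And>n. x < X n" "\<And>n. X n < x + 1 / real (Suc n)" by metis
  have "X \<longlonglongrightarrow> x"
  proof (rule tendsto_sandwich[OF _ _ tendsto_const])
    show "(\<lambda>n. x + 1 / real (Suc n)) \<longlonglongrightarrow> x"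
      using tendsto_add[OF tendsto_const LIMSEQ_inverse_real_of_nat, of x] by (simp add: field_simps)
  qed (intro always_eventually allI less_imp_le X)+
  with X show ?thesis using that by blast
qed

text \<open>The positive and the negative part of f have equal Fourier transforms; frequency 0 shows
  that they have the same mass c. If c = 0 both vanish; otherwise dividing by c makes them
  probability densities with the same characteristic function, and the uniqueness theorem for
  characteristic functions applies.\<close>

lemma fourier_unique_real:
  fixes f :: "real \<Rightarrow> real"
  assumes f: "integrable lborel f" and zero: "\<And>k. (LINT x|lborel. iexp (k * x) * f x) = 0"
  shows "AE x in lborel. f x = 0"
proof -
  define p n where "p = (\<lambda>x. max 0 (f x))" and "n = (\<lambda>x. max 0 (- f x))"
  have [measurable]: "f \<in> borel_measurable borel" using f by auto
  have [measurable]: "p \<in> borel_measurable borel" "n \<in> borel_measurable borel"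
    unfolding p_def n_def by measurable
  have ip: "integrable lborel p" "integrable lborel n" unfolding p_def n_def using f by auto
  have pn: "p x \<ge> 0" "n x \<ge> 0" "f x = p x - n x" for x by (auto simp: p_def n_def)
  have iexp_int: "integrable lborel (\<lambda>x. iexp (k * x) * complex_of_real (g x))"
    if "integrable lborel g" for g k
    by (rule Bochner_Integration.integrable_bound[OF that]) (use that in \<open>auto simp: norm_mult\<close>)
  have eq: "(LINT x|lborel. iexp (k * x) * p x) = (LINT x|lborel. iexp (k * x) * n x)" for k
    using zero[of k] iexp_int[OF ip(1), of k] iexp_int[OF ip(2), of k]
    by (simp add: pn(3) right_diff_distrib)
  define c where "c = (LINT x|lborel. p x)"
  have "complex_of_real c = complex_of_real (LINT x|lborel. n x)"
    using eq[of 0] by (simp add: c_def)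
  then have cn: "c = (LINT x|lborel. n x)" by (simp only: of_real_eq_iff)
  have "c \<ge> 0" unfolding c_def using pn by simp
  show ?thesis
  proof (cases "c = 0")
    case True
    then have "AE x in lborel. p x = 0" "AE x in lborel. n x = 0"
      using ip pn integral_nonneg_eq_0_iff_AE[of lborel p] integral_nonneg_eq_0_iff_AE[of lborel n]
      by (auto simp: c_def[symmetric] cn[symmetric])
    then show ?thesis by eventually_elim (simp add: pn)
  next
    case False
    then have c: "c > 0" using \<open>c \<ge> 0\<close> by simp
    have dist: "real_distribution (density lborel (\<lambda>x. ennreal (g x / c)))"
      if "integrable lborel g" "\<And>x. g x \<ge> 0" "(LINT x|lborel. g x) = c" for g
    proof -
      have "(\<integral>\<^sup>+x. ennreal (g x / c) \<partial>lborel) = ennreal (LINT x|lborel. g x / c)"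
        using that c by (intro nn_integral_eq_integral) auto
      also have "\<dots> = 1" using that c by simp
      finally show ?thesis using that
        by (intro real_distribution.intro prob_spaceI real_distribution_axioms.intro)
          (auto simp: emeasure_density)
    qed
    have char_eq: "char (density lborel (\<lambda>x. ennreal (g x / c))) k = (LINT x|lborel. iexp (k * x) * g x) / c"
      if "integrable lborel g" "\<And>x. g x \<ge> 0" for g k
      unfolding char_def using that c
      by (subst integral_density) (auto simp: scaleR_conv_of_real mult.commute)
    have "density lborel (\<lambda>x. ennreal (p x / c)) = density lborel (\<lambda>x. ennreal (n x / c))"
      by (rule Levy_uniqueness) (use dist ip pn eq cn c_def char_eq in \<open>auto simp: fun_eq_iff\<close>)
    then have "AE x in lborel. ennreal (p x / c) = ennreal (n x / c)"
      by (subst (asm) sigma_finite_measure.density_unique_iff[OF sigma_finite_lborel]) auto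
    then show ?thesis by eventually_elim (use c pn in auto)
  qed
qed

text \<open>Dominated convergence extends the vanishing from rational to real frequencies. The
  transform of \<open>cnj (F x)\<close> at k is the conjugate of the transform of F at -k, so it
  vanishes too; hence so do the transforms of the real and the imaginary part, which are covered by
  the real case.\<close>

lemma determining_fourier:
  "determining lborel UNIV ((\<lambda>q x. exp (- \<i> * of_real (q * x))) ` (\<rat> :: real set))"
  unfolding determining_def
proof (intro conjI allI impI ballI; (elim imageE)?)
  fix F :: "real \<Rightarrow> complex"
  assume F: "integrable lborel F"
    and I: "\<forall>e\<in>(\<lambda>q x. exp (- \<i> * of_real (q * x))) ` (\<rat> :: real set). (LINT x|lborel. e x * F x) = 0"
  have [measurable]: "F \<in> borel_measurable borel" using F by auto
  have all: "(LINT x|lborel. iexp (k * x) * F x) = 0" for k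
  proof -
    obtain X where X: "\<And>n. X n \<in> \<rat>" "X \<longlonglongrightarrow> - k" using rational_approximation by metis
    have lim: "(\<lambda>n. exp (- \<i> * of_real (X n * x)) * F x) \<longlonglongrightarrow> exp (- \<i> * of_real (- k * x)) * F x" for x
      by (intro tendsto_intros X)
    have "(\<lambda>n. LINT x|lborel. exp (- \<i> * of_real (X n * x)) * F x)
        \<longlonglongrightarrow> (LINT x|lborel. exp (- \<i> * of_real (- k * x)) * F x)"
      by (rule integral_dominated_convergence[where w="\<lambda>x. norm (F x)"])
        (use F in \<open>auto simp: norm_mult intro!: AE_I2 lim[simplified]\<close>)
    moreover have "(\<lambda>n. LINT x|lborel. exp (- \<i> * of_real (X n * x)) * F x) = (\<lambda>n. 0)"
      using I X by auto
    ultimately have "(LINT x|lborel. exp (- \<i> * of_real (- k * x)) * F x) = 0"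
      using LIMSEQ_unique[OF tendsto_const] by metis
    then show ?thesis by simp
  qed
  have iF: "integrable lborel (\<lambda>x. iexp (k * x) * F x)" for k
    by (rule integrable_mult_supported[OF F, where S=UNIV]) auto
  have cnj: "(LINT x|lborel. iexp (k * x) * cnj (F x)) = 0" for k
  proof -
    have "(LINT x|lborel. iexp (k * x) * cnj (F x)) = (LINT x|lborel. cnj (iexp (- k * x) * F x))"
      by (intro Bochner_Integration.integral_cong) (auto simp: exp_cnj)
    also have "\<dots> = cnj (LINT x|lborel. iexp (- k * x) * F x)"
      by (rule Bochner_Integration.integral_cnj)
    also have "\<dots> = 0" by (simp only: all complex_cnj_zero)
    finally show ?thesis .
  qed
  have icF: "integrable lborel (\<lambda>x. iexp (k * x) * cnj (F x))" for k
    by (rule integrable_mult_supported[where S=UNIV]) (use F in auto)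
  have "(LINT x|lborel. iexp (k * x) * of_real (Re (F x))) = 0" for k
  proof -
    have "(LINT x|lborel. iexp (k * x) * of_real (Re (F x)))
       = (LINT x|lborel. (iexp (k * x) * F x + iexp (k * x) * cnj (F x)) / 2)"
      by (intro Bochner_Integration.integral_cong refl)
        (simp add: distrib_left[symmetric] complex_add_cnj)
    also have "\<dots> = 0" using all[of k] cnj[of k] iF[of k] icF[of k] by simp
    finally show ?thesis .
  qed
  then have 1: "AE x in lborel. Re (F x) = 0" using F by (intro fourier_unique_real) auto
  have "(LINT x|lborel. iexp (k * x) * of_real (Im (F x))) = 0" for k
  proof -
    have "(LINT x|lborel. iexp (k * x) * of_real (Im (F x)))
       = (LINT x|lborel. (iexp (k * x) * F x - iexp (k * x) * cnj (F x)) / (2 * \<i>))"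
    proof (intro Bochner_Integration.integral_cong refl)
      fix x
      have "of_real (Im (F x)) = (F x - cnj (F x)) / (2 * \<i>)" by (simp add: complex_eq_iff)
      then show "iexp (k * x) * of_real (Im (F x)) = (iexp (k * x) * F x - iexp (k * x) * cnj (F x)) / (2 * \<i>)"
        by (simp only: right_diff_distrib times_divide_eq_right)
    qed
    also have "\<dots> = 0" using all[of k] cnj[of k] iF[of k] icF[of k] by simp
    finally show ?thesis .
  qed
  then have 2: "AE x in lborel. Im (F x) = 0" using F by (intro fourier_unique_real) auto
  from 1 2 show "AE x in lborel. F x = 0" by eventually_elim (simp add: complex_eq_iff)
qed auto

section \<open>Injectivity of the Laplace transform\<close>

text \<open>Mean value inequality on the disc of radius |w|. It provides the majorant for the
  difference quotients of the Laplace kernel.\<close>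

lemma norm_exp_minus_one_le: "norm (exp w - 1) \<le> norm w * exp (norm w)" for w :: complex
proof -
  have "norm (exp w - exp 0) \<le> exp (norm w) * norm (w - 0)"
  proof (rule field_differentiable_bound[where S="cball 0 (norm w)" and f'=exp])
    fix z :: complex assume "z \<in> cball 0 (norm w)"
    then show "norm (exp z) \<le> exp (norm w)"
      using complex_Re_le_cmod[of z] by (auto simp: norm_exp_eq_Re)
  qed (auto intro!: derivative_eq_intros)
  then show ?thesis by (simp add: mult.commute)
qed

lemma laplace_has_field_derivative:
  fixes F :: "real \<Rightarrow> complex"
  assumes F: "integrable lborel F" and F0: "\<And>t. t < 0 \<Longrightarrow> F t = 0" and z: "Re z > 0"
  shows "((\<lambda>z. LINT t|lborel. exp (- z * of_real t) * F t) has_field_derivative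
           (LINT t|lborel. - of_real t * exp (- z * of_real t) * F t)) (at z)"
proof -
  have [measurable]: "F \<in> borel_measurable borel" using F by auto
  \<comment> \<open>Half of the decay rate: an increment with |h| < \<rho> costs at most a factor
    exp (\<rho> t) out of exp (-2 \<rho> t), and the remaining t exp (- \<rho> t) is at most 1 /
    \<rho>.\<close>
  define \<rho> where "\<rho> = Re z / 2"
  have \<rho>: "\<rho> > 0" using z by (simp add: \<rho>_def)
  have int: "integrable lborel (\<lambda>t. exp (- w * of_real t) * F t)" if "Re w > 0" for w
    by (rule integrable_mult_supported[OF F, where S="{0..}"])
      (use F0 that in \<open>auto simp: norm_exp_eq_Re\<close>)
  have bound: "norm ((exp (- (z + h) * of_real t) - exp (- z * of_real t)) / h * F t) \<le> norm (F t) / \<rho>"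
    if h: "norm h < \<rho>" "h \<noteq> 0" for h t
  proof (cases "t < 0")
    case False
    then have t: "t \<ge> 0" by simp
    define D where "D = exp (- (z + h) * of_real t) - exp (- z * of_real t)"
    have "D = exp (- z * of_real t) * (exp (- h * of_real t) - 1)"
      by (simp add: D_def exp_add[symmetric] algebra_simps)
    then have "norm D
        \<le> exp (- (2 * \<rho> * t)) * (norm h * t * exp (norm h * t))"
      using norm_exp_minus_one_le[of "- h * of_real t"] t
      by (simp add: norm_mult norm_exp_eq_Re \<rho>_def)
    also have "\<dots> \<le> exp (- (2 * \<rho> * t)) * (norm h * t * exp (\<rho> * t))"
      using h t by (intro mult_left_mono) (auto intro!: mult_right_mono)
    also have "\<dots> = norm h * (t * exp (- (\<rho> * t)))"
      by (simp add: exp_minus exp_add[symmetric] field_simps)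
    also have "t * exp (- (\<rho> * t)) \<le> 1 / \<rho>"
    proof -
      have "\<rho> * t \<le> exp (\<rho> * t)" using exp_ge_add_one_self[of "\<rho> * t"] by linarith
      then show ?thesis using \<rho> by (simp add: exp_minus field_simps)
    qed
    finally have "norm D \<le> norm h * (1 / \<rho>)"
      by (simp add: mult_left_mono)
    then have "norm (D / h) \<le> 1 / \<rho>"
      using h \<rho> by (simp add: norm_divide divide_simps mult.commute)
    from mult_right_mono[OF this, of "norm (F t)"] show ?thesis by (simp add: D_def norm_mult norm_divide)
  qed (use F0 \<rho> in simp)
  \<comment> \<open>Restricting the limit to the ball makes every test sequence satisfy the bound
    from its first term on; the ball is open, so the limit at 0 is the same.\<close>
  have "((\<lambda>h. ((LINT t|lborel. exp (- (z + h) * of_real t) * F t) - (LINT t|lborel. exp (- z * of_real t) * F t)) / h)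
          \<longlongrightarrow> (LINT t|lborel. - of_real t * exp (- z * of_real t) * F t)) (at 0 within ball 0 \<rho>)"
    unfolding tendsto_at_iff_sequentially comp_def
  proof (intro allI impI)
    fix X :: "nat \<Rightarrow> complex" assume X: "\<forall>i. X i \<in> ball 0 \<rho> - {0}" "X \<longlonglongrightarrow> 0"
    have "(\<lambda>n. LINT t|lborel. (exp (- (z + X n) * of_real t) - exp (- z * of_real t)) / X n * F t)
        \<longlonglongrightarrow> (LINT t|lborel. - of_real t * exp (- z * of_real t) * F t)"
    proof (rule integral_dominated_convergence[where w="\<lambda>t. norm (F t) / \<rho>"])
      show "AE t in lborel. (\<lambda>n. (exp (- (z + X n) * of_real t) - exp (- z * of_real t)) / X n * F t)
          \<longlonglongrightarrow> - of_real t * exp (- z * of_real t) * F t"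
      proof (intro AE_I2 tendsto_mult_right)
        fix t :: real
        have "((\<lambda>w. exp (- w * of_real t)) has_field_derivative - of_real t * exp (- z * of_real t)) (at z)"
          by (auto intro!: derivative_eq_intros)
        then have "((\<lambda>h. (exp (- (z + h) * of_real t) - exp (- z * of_real t)) / h)
            \<longlongrightarrow> - of_real t * exp (- z * of_real t)) (at 0)"
          by (simp only: DERIV_def)
        then show "(\<lambda>n. (exp (- (z + X n) * of_real t) - exp (- z * of_real t)) / X n)
            \<longlonglongrightarrow> - of_real t * exp (- z * of_real t)"
          using X unfolding tendsto_at_iff_sequentially comp_def by auto
      qed
      show "AE t in lborel. norm ((exp (- (z + X n) * of_real t) - exp (- z * of_real t)) / X n * F t) \<le> norm (F t) / \<rho>" for n
        using X(1) bound by auto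
    qed (use F in auto)
    moreover have "(LINT t|lborel. (exp (- (z + X n) * of_real t) - exp (- z * of_real t)) / X n * F t)
        = ((LINT t|lborel. exp (- (z + X n) * of_real t) * F t) - (LINT t|lborel. exp (- z * of_real t) * F t)) / X n" for n
    proof -
      have "norm (X n) < \<rho>" using X(1) by auto
      then have "Re (z + X n) > 0" using abs_Re_le_cmod[of "X n"] z by (simp add: \<rho>_def)
      with int[of "z + X n"] int[of z] z show ?thesis
        by (simp add: diff_divide_distrib left_diff_distrib)
    qed
    ultimately show "(\<lambda>n. ((LINT t|lborel. exp (- (z + X n) * of_real t) * F t) - (LINT t|lborel. exp (- z * of_real t) * F t)) / X n)
        \<longlonglongrightarrow> (LINT t|lborel. - of_real t * exp (- z * of_real t) * F t)" by (simp only:)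
  qed
  moreover have "at 0 within ball 0 \<rho> = at (0 :: complex)" using \<rho> by (intro at_within_open) auto
  ultimately show ?thesis by (simp only: DERIV_def)
qed

text \<open>The identity theorem spreads the zeros from a short interval to the whole right half
  plane. On a vertical line in that half plane the Laplace transform is a Fourier transform, which
  reduces injectivity to \<open>determining_fourier\<close>.\<close>

lemma determining_laplace:
  assumes \<delta>: "\<delta> > 0"
  shows "determining lborel {0..} ((\<lambda>\<sigma> t. exp (- of_real (\<sigma> * t))) ` (\<rat> \<inter> {0<..<\<delta>} :: real set))"
  unfolding determining_def
proof (intro conjI allI impI ballI; (elim imageE)?)
  fix F :: "real \<Rightarrow> complex"
  assume F: "integrable lborel F" and F0: "\<forall>t. t \<notin> {0..} \<longrightarrow> F t = 0"
    and I: "\<forall>e\<in>(\<lambda>\<sigma> t. exp (- of_real (\<sigma> * t))) ` (\<rat> \<inter> {0<..<\<delta>} :: real set). (LINT t|lborel. e t * F t) = 0"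
  have [measurable]: "F \<in> borel_measurable borel" using F by auto
  define L where "L = (\<lambda>z. LINT t|lborel. exp (- z * of_real t) * F t)"
  have L0: "L w = 0" if w: "Re w > 0" for w
  proof (rule analytic_continuation[where f=L and S="{z. Re z > 0}"
        and U="of_real ` (\<rat> \<inter> {0<..<\<delta>})" and \<xi>="of_real (\<delta> / 2)"])
    show "L holomorphic_on {z. Re z > 0}"
      unfolding holomorphic_on_def field_differentiable_def L_def
      by (rule ballI, rule exI, rule has_field_derivative_at_within, rule laplace_has_field_derivative[OF F])
        (use F0 in auto)
    \<comment> \<open>The limit point has to lie inside the domain of holomorphy. The midpoint of
      the interval does, whereas 0 is on the boundary.\<close>
    show "of_real (\<delta> / 2) islimpt (of_real ` (\<rat> \<inter> {0<..<\<delta>}) :: complex set)"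
    proof -
      obtain X where X: "\<And>n. X n \<in> \<rat>" "\<And>n. \<delta> / 2 < X n" "X \<longlonglongrightarrow> \<delta> / 2"
        using rational_approximation by metis
      have "eventually (\<lambda>n. X n < \<delta>) sequentially"
        by (rule order_tendstoD(2)[OF X(3)]) (use \<delta> in simp)
      then obtain m where m: "\<And>n. n \<ge> m \<Longrightarrow> X n < \<delta>" by (auto simp: eventually_sequentially)
      have "X (n + m) \<in> \<rat> \<inter> {0<..<\<delta>} \<and> X (n + m) \<noteq> \<delta> / 2" for n
        using X(1)[of "n + m"] X(2)[of "n + m"] m[of "n + m"] \<delta> by auto
      moreover have "(\<lambda>n. complex_of_real (X (n + m))) \<longlonglongrightarrow> of_real (\<delta> / 2)"
        by (intro tendsto_of_real LIMSEQ_ignore_initial_segment X)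
      ultimately show ?thesis
        unfolding islimpt_sequential
        by (intro exI[of _ "\<lambda>n. of_real (X (n + m))"]) (auto simp del: of_real_divide)
    qed
    fix z :: complex assume "z \<in> of_real ` (\<rat> \<inter> {0<..<\<delta>})"
    then show "L z = 0" using I by (auto simp: L_def)
  qed (use \<delta> w in \<open>auto simp: open_halfspace_Re_gt convex_halfspace_Re_gt convex_connected\<close>)
  \<comment> \<open>On the line Re z = 1 the transform of F at 1 + iq is the Fourier transform of
    exp (-t) F(t) at q.\<close>
  have "AE t in lborel. exp (- of_real t) * F t = 0"
  proof (rule determiningD[OF determining_fourier])
    show "integrable lborel (\<lambda>t. exp (- of_real t) * F t)"
      by (rule integrable_mult_supported[OF F, where S="{0..}"]) (use F0 in \<open>auto simp: norm_exp_eq_Re\<close>)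
    fix e assume "e \<in> (\<lambda>q x. exp (- \<i> * of_real (q * x))) ` (\<rat> :: real set)"
    then obtain q :: real where e: "e = (\<lambda>x. exp (- \<i> * of_real (q * x)))" by auto
    have "(LINT t|lborel. e t * (exp (- of_real t) * F t)) = L (1 + \<i> * of_real q)"
      unfolding L_def e
      by (intro Bochner_Integration.integral_cong) (auto simp: exp_add[symmetric] algebra_simps)
    also have "\<dots> = 0" by (rule L0) simp
    finally show "(LINT t|lborel. e t * (exp (- of_real t) * F t)) = 0" .
  qed auto
  then show "AE t in lborel. F t = 0" by simp
qed (auto simp: norm_exp_eq_Re)

section \<open>The change of variables\<close>

text \<open>The simplifier would otherwise rewrite products with the transpose into row-vector
  products, while the facts below are stated for \<open>transpose T_mat *v w\<close>.\<close>

declare transpose_matrix_vector [simp del]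

lemma first_le: "first \<le> (i :: 'n::{finite,wellorder})"
  unfolding first_def by (rule Least_le) simp

lemma T_mat_mult_nth:
  "(T_mat *v x) $ i = (if i = first then x $ first else x $ first + x $ i)" for x :: "real^'n::{finite,wellorder}"
proof -
  have "(T_mat *v x) $ i = (\<Sum>j\<in>UNIV. (if j = first \<or> i = j then x $ j else 0))"
    unfolding matrix_vector_mult_def T_mat_def by (auto intro!: sum.cong)
  also have "\<dots> = (\<Sum>j\<in>{first, i}. x $ j)"
    by (simp add: sum.If_cases) (intro sum.cong; auto)
  finally show ?thesis by (auto simp: insert_absorb)
qed

lemma transpose_T_mat_mult_nth:
  "(transpose T_mat *v w) $ i = (if i = first then \<Sum>j\<in>UNIV. w $ j else w $ i)"
  for w :: "real^'n::{finite,wellorder}"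
  unfolding matrix_vector_mult_def transpose_def T_mat_def
  by (auto simp: if_distrib[of "\<lambda>x. x * _"] cong: if_cong)

lemma inner_transpose_T_mat: "(transpose T_mat *v w) \<bullet> t = w \<bullet> (T_mat *v t)"
  by (simp add: transpose_matrix_vector dot_lmul_matrix)

lemma det_T_mat: "det (T_mat :: real^('n::{finite,wellorder})^('n::{finite,wellorder})) = 1"
proof -
  have "det (T_mat :: ((real, 'n) vec, 'n) vec) = (\<Prod>i\<in>UNIV. (T_mat :: ((real, 'n) vec, 'n) vec) $ i $ i)"
    \<comment> \<open>Off the diagonal only the first column is nonzero, and nothing in that column
      lies above the diagonal because \<open>first\<close> is the least index.\<close>
    by (rule det_lowerdiagonal) (use first_le in \<open>auto simp: T_mat_def not_less[symmetric]\<close>)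
  then show ?thesis by (simp add: T_mat_def)
qed

lemma matrix_inv_T_mat:
  "T_mat ** matrix_inv T_mat = (mat 1 :: real^('n::{finite,wellorder})^('n::{finite,wellorder}))"
  "matrix_inv T_mat ** T_mat = (mat 1 :: real^('n::{finite,wellorder})^('n::{finite,wellorder}))"
proof -
  have "invertible (T_mat :: ((real, 'n) vec, 'n) vec)" by (simp add: invertible_det_nz det_T_mat)
  then have "\<exists>B. T_mat ** B = (mat 1 :: ((real, 'n) vec, 'n) vec) \<and> B ** T_mat = (mat 1 :: ((real, 'n) vec, 'n) vec)"
    by (simp add: invertible_def)
  from someI_ex[OF this]
  show "T_mat ** matrix_inv T_mat = (mat 1 :: ((real, 'n) vec, 'n) vec)" "matrix_inv T_mat ** T_mat = (mat 1 :: ((real, 'n) vec, 'n) vec)"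
    by (auto simp: matrix_inv_def)
qed

lemma T_mat_inverse:
  "T_mat *v (matrix_inv T_mat *v x) = x" "matrix_inv T_mat *v (T_mat *v x) = x"
  for x :: "real^'n::{finite,wellorder}"
  by (simp_all add: matrix_vector_mul_assoc matrix_inv_T_mat)

text \<open>Adding the first coordinate to all others keeps the differences among the others and
  turns nonnegativity of the others into the condition that they are not below the first.\<close>

lemma T_mat_B_cone: "T_mat *v t \<in> A_cone \<longleftrightarrow> t \<in> B_cone" for t :: "real^'n::{finite,wellorder}"
proof
  assume A: "T_mat *v t \<in> A_cone"
  show "t \<in> B_cone"
    unfolding B_cone_def
  proof (intro CollectI conjI allI impI; (elim conjE)?)
    show "0 < t $ first" using A by (auto simp: A_cone_def T_mat_mult_nth)
    fix i assume i: "i \<noteq> (first :: 'n)"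
    from A have "(T_mat *v t) $ first \<le> (T_mat *v t) $ i" using first_le[of i] unfolding A_cone_def by blast
    then show "0 \<le> t $ i" using i by (simp add: T_mat_mult_nth)
    fix j assume "i \<le> j"
    then have "j \<noteq> first" using i first_le[of i] by auto
    moreover from A have "(T_mat *v t) $ i \<le> (T_mat *v t) $ j" using \<open>i \<le> j\<close> unfolding A_cone_def by blast
    ultimately show "t $ i \<le> t $ j" using i by (simp add: T_mat_mult_nth)
  qed
next
  assume B: "t \<in> B_cone"
  show "T_mat *v t \<in> A_cone"
    unfolding A_cone_def
  proof (intro CollectI conjI allI impI)
    show "0 < (T_mat *v t) $ first" using B by (auto simp: B_cone_def T_mat_mult_nth)
    fix i j :: 'n assume "i \<le> j"
    moreover have "j \<noteq> first" if "i \<noteq> first" using that \<open>i \<le> j\<close> first_le[of i] by auto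
    ultimately show "(T_mat *v t) $ i \<le> (T_mat *v t) $ j" using B
      by (auto simp: B_cone_def T_mat_mult_nth)
  qed
qed

section \<open>Invariance of Lebesgue measure under the unimodular map\<close>

lemma emeasure_lborel_box_cart:
  fixes l u :: "real^'n"
  assumes "\<And>i. l $ i \<le> u $ i"
  shows "emeasure lborel (box l u) = (\<Prod>i\<in>UNIV. ennreal (u $ i - l $ i))"
proof -
  have le: "l \<bullet> b \<le> u \<bullet> b" if "b \<in> Basis" for b
    using that assms by (auto simp: Basis_vec_def inner_axis)
  have "emeasure lborel (box l u) = (\<Prod>b\<in>Basis. ennreal ((u - l) \<bullet> b))"
    by (subst emeasure_lborel_box[OF le], assumption, subst prod_ennreal) (simp_all add: inner_diff_left le)
  also have "Basis = range (\<lambda>i. axis i 1 :: real^'n)" by (auto simp: Basis_vec_def)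
  also have "(\<Prod>b\<in>\<dots>. ennreal ((u - l) \<bullet> b)) = (\<Prod>i\<in>UNIV. ennreal (u $ i - l $ i))"
    by (subst prod.reindex) (auto simp: inj_on_def axis_eq_axis inner_axis)
  finally show ?thesis .
qed

lemma lborel_cart_eqI:
  fixes M :: "(real^'n) measure"
  assumes "\<And>l u. (\<And>i. l $ i \<le> u $ i) \<Longrightarrow> emeasure M (box l u) = emeasure lborel (box l u)"
    and "sets M = sets borel"
  shows "M = lborel"
proof (rule lborel_eqI[symmetric, OF _ assms(2)])
  fix l u :: "real^'n" assume le: "\<And>b. b \<in> Basis \<Longrightarrow> l \<bullet> b \<le> u \<bullet> b"
  have "l $ i \<le> u $ i" for i using le[of "axis i 1"] by (simp add: inner_axis)
  then show "emeasure M (box l u) = (\<Prod>b\<in>Basis. (u - l) \<bullet> b)"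
    using assms(1) le by simp
qed

lemma distr_T_mat:
  "distr lborel borel ((*v) T_mat) = (lborel :: (real^'n::{finite,wellorder}) measure)"
proof (rule lborel_cart_eqI)
  fix l u :: "(real, 'n) vec" assume "\<And>i. l $ i \<le> u $ i"
  let ?S = "(*v) T_mat -` box l u" and ?f = "(*v) (matrix_inv T_mat) :: (real, 'n) vec \<Rightarrow> (real, 'n) vec"
  have lin: "linear ?f" by simp
  have S: "?S = ?f ` box l u"
  proof (intro equalityI subsetI)
    fix x assume "x \<in> ?S"
    then show "x \<in> ?f ` box l u" by (intro image_eqI[of _ _ "T_mat *v x"]) (auto simp: T_mat_inverse)
  qed (auto simp: T_mat_inverse)
  have "det (matrix_inv T_mat :: ((real, 'n) vec, 'n) vec) * det (T_mat :: ((real, 'n) vec, 'n) vec) = det (mat 1 :: ((real, 'n) vec, 'n) vec)"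
    by (simp add: det_mul[symmetric] matrix_inv_T_mat)
  then have det: "det (matrix_inv T_mat :: ((real, 'n) vec, 'n) vec) = 1" by (simp add: det_T_mat)
  \<comment> \<open>The image formula with the determinant concerns the completed measure and finite
    values; the box is bounded and the preimage is Borel, which allows the return to
    \<open>lborel\<close> and to \<open>emeasure\<close>.\<close>
  have meas: "measure lebesgue ?S = measure lebesgue (box l u)" "?S \<in> lmeasurable"
    unfolding S by (simp_all add: measure_linear_image[OF lin] measurable_linear_image[OF lin] det)
  have S_borel: "?S \<in> sets borel"
    using measurable_sets[of "(*v) T_mat" borel borel "box l u"]
    by (simp add: borel_measurable_continuous_onI matrix_vector_mult_linear_continuous_on)
  have "emeasure lborel ?S = emeasure lebesgue ?S" using S_borel by simp
  also have "\<dots> = emeasure lebesgue (box l u)"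
    using meas by (simp add: emeasure_eq_measure2)
  finally show "emeasure (distr lborel borel ((*v) T_mat)) (box l u) = emeasure lborel (box l u)"
    by (subst emeasure_distr)
      (simp_all add: borel_measurable_continuous_onI matrix_vector_mult_linear_continuous_on)
qed simp

definition T_pair :: "(real^'n::{finite,wellorder}) \<times> (real^'n::{finite,wellorder}) \<Rightarrow> (real^'n::{finite,wellorder}) \<times> (real^'n::{finite,wellorder})" where
  "T_pair = (\<lambda>(x, t). (T_mat *v x, T_mat *v t))"

definition T_inv_pair :: "(real^'n::{finite,wellorder}) \<times> (real^'n::{finite,wellorder}) \<Rightarrow> (real^'n::{finite,wellorder}) \<times> (real^'n::{finite,wellorder})" where
  "T_inv_pair = (\<lambda>(x, t). (matrix_inv T_mat *v x, matrix_inv T_mat *v t))"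

lemma T_pair_inverse [simp]: "T_pair (T_inv_pair z) = z" "T_inv_pair (T_pair z) = z"
  by (auto simp: T_pair_def T_inv_pair_def T_mat_inverse split: prod.splits)

lemma T_op_eq: "T_op f = (\<lambda>z. f (T_pair z))" "T_inv_op f = (\<lambda>z. f (T_inv_pair z))"
  by (auto simp: T_op_def T_inv_op_def T_pair_def T_inv_pair_def)

lemma measurable_T_pair [measurable]:
  "(T_pair :: (real^'n::{finite,wellorder}) \<times> (real^'n::{finite,wellorder}) \<Rightarrow> _) \<in> borel \<rightarrow>\<^sub>M borel"
  "(T_inv_pair :: (real^'n::{finite,wellorder}) \<times> (real^'n::{finite,wellorder}) \<Rightarrow> _) \<in> borel \<rightarrow>\<^sub>M borel"
proof -
  have [measurable]: "(*v) A \<in> borel \<rightarrow>\<^sub>M borel" for A :: "((real, 'n) vec, 'n) vec"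
    by (intro borel_measurable_continuous_onI continuous_intros)
  show "(T_pair :: (real, 'n) vec \<times> (real, 'n) vec \<Rightarrow> _) \<in> borel \<rightarrow>\<^sub>M borel"
    "(T_inv_pair :: (real, 'n) vec \<times> (real, 'n) vec \<Rightarrow> _) \<in> borel \<rightarrow>\<^sub>M borel"
    unfolding T_pair_def T_inv_pair_def borel_prod[symmetric] by measurable
qed

lemma distr_T_pair:
  "distr lborel borel T_pair = (lborel :: ((real^'n::{finite,wellorder}) \<times> (real^'n::{finite,wellorder})) measure)"
proof -
  have "sigma_finite_measure (distr lborel borel ((*v) T_mat) :: (real, 'n) vec measure)"
    by (simp add: distr_T_mat sigma_finite_lborel)
  from pair_measure_distr[OF _ _ this, of "(*v) T_mat" lborel borel, symmetric]
  have "distr (lborel \<Otimes>\<^sub>M lborel) (borel \<Otimes>\<^sub>M borel) T_pair = (lborel \<Otimes>\<^sub>M lborel :: (((real, 'n) vec) \<times> ((real, 'n) vec)) measure)"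
    by (simp add: distr_T_mat T_pair_def borel_measurable_continuous_onI matrix_vector_mult_linear_continuous_on)
  then show ?thesis by (simp add: lborel_prod borel_prod)
qed

lemma distr_T_inv_pair: "distr lborel borel T_inv_pair = lborel"
proof -
  have "lborel = distr lborel borel (\<lambda>z. T_inv_pair (T_pair z))"
    by (simp add: distr_id2)
  also have "\<dots> = distr (distr lborel borel T_pair) borel T_inv_pair"
    by (subst distr_distr) (auto simp: comp_def)
  also note distr_T_pair
  finally show ?thesis by (rule sym)
qed

lemma AE_T_pair: "AE z in lborel. P z \<Longrightarrow> AE z in lborel. P (T_pair z)"
  using AE_distrD[of T_pair lborel borel P, unfolded distr_T_pair] by simp

lemma AE_T_inv_pair: "AE z in lborel. P z \<Longrightarrow> AE z in lborel. P (T_inv_pair z)"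
  using AE_distrD[of T_inv_pair lborel borel P, unfolded distr_T_inv_pair] by simp

lemma integrable_T_pair:
  fixes F :: "(real^'n::{finite,wellorder}) \<times> (real^'n::{finite,wellorder}) \<Rightarrow> complex"
  shows "integrable lborel F \<Longrightarrow> integrable lborel (\<lambda>z. F (T_pair z))"
  using integrable_distr[of T_pair lborel borel F] by (simp add: distr_T_pair)

lemma integrable_T_inv_pair:
  fixes F :: "(real^'n::{finite,wellorder}) \<times> (real^'n::{finite,wellorder}) \<Rightarrow> complex"
  shows "integrable lborel F \<Longrightarrow> integrable lborel (\<lambda>z. F (T_inv_pair z))"
  using integrable_distr[of T_inv_pair lborel borel F] by (simp add: distr_T_inv_pair)

lemma integral_T_pair:
  fixes F :: "(real^'n::{finite,wellorder}) \<times> (real^'n::{finite,wellorder}) \<Rightarrow> complex"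
  assumes [measurable]: "F \<in> borel_measurable borel"
  shows "(LINT z|lborel. F (T_pair z)) = (LINT z|lborel. F z)"
  using integral_distr[of T_pair lborel borel F] by (simp add: distr_T_pair)

section \<open>Transport of the weighted spaces and of the transform\<close>

lemma L1_borel_measurable:
  fixes w :: "real^'n"
  assumes "f \<in> L1 w" shows "f \<in> borel_measurable borel"
proof -
  have "(\<lambda>(x, t). exp (- (w \<bullet> t)) *\<^sub>R f (x, t)) \<in> borel_measurable borel"
    using borel_measurable_integrable[of lborel] assms by (fastforce simp: L1_def)
  moreover have "(\<lambda>z :: (real^'n) \<times> (real^'n). exp (w \<bullet> snd z)) \<in> borel_measurable borel"
    by (intro borel_measurable_continuous_onI continuous_intros)
  ultimately have "(\<lambda>z. exp (w \<bullet> snd z) *\<^sub>R (\<lambda>(x, t). exp (- (w \<bullet> t)) *\<^sub>R f (x, t)) z) \<in> borel_measurable borel"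
    by (intro borel_measurable_scaleR)
  also have "(\<lambda>z. exp (w \<bullet> snd z) *\<^sub>R (\<lambda>(x, t). exp (- (w \<bullet> t)) *\<^sub>R f (x, t)) z) = f"
    by (auto simp: exp_minus)
  finally show ?thesis .
qed

lemma T_op_B_space:
  assumes "f \<in> A_space \<omega>" shows "T_op f \<in> B_space \<omega>"
proof -
  have "integrable lborel (\<lambda>z. (\<lambda>(x, t). exp (- (\<omega> \<bullet> t)) *\<^sub>R f (x, t)) (T_pair z))"
    by (rule integrable_T_pair) (use assms in \<open>auto simp: A_space_def L1_def\<close>)
  also have "(\<lambda>z. (\<lambda>(x, t). exp (- (\<omega> \<bullet> t)) *\<^sub>R f (x, t)) (T_pair z))
      = (\<lambda>(x, t). exp (- ((transpose T_mat *v \<omega>) \<bullet> t)) *\<^sub>R T_op f (x, t))"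
    by (auto simp: T_op_def T_pair_def inner_transpose_T_mat)
  moreover have "AE z in lborel. (\<lambda>(x, t). t \<notin> A_cone \<longrightarrow> f (x, t) = 0) (T_pair z)"
    by (rule AE_T_pair) (use assms in \<open>auto simp: A_space_def\<close>)
  then have "AE (x, t) in lborel. t \<notin> B_cone \<longrightarrow> T_op f (x, t) = 0"
    by eventually_elim (auto simp: T_op_def T_pair_def T_mat_B_cone)
  ultimately show ?thesis by (simp add: B_space_def L1_def)
qed

lemma T_inv_op_A_space:
  fixes \<omega> :: "real^'n::{finite,wellorder}"
  assumes "g \<in> B_space \<omega>" shows "T_inv_op g \<in> A_space \<omega>"
proof -
  have eq: "(transpose T_mat *v \<omega>) \<bullet> (matrix_inv T_mat *v t) = \<omega> \<bullet> t" for t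
    by (simp add: inner_transpose_T_mat T_mat_inverse)
  have cone: "matrix_inv T_mat *v t \<in> B_cone \<longleftrightarrow> t \<in> A_cone" for t :: "(real, 'n) vec"
    by (simp add: T_mat_B_cone[symmetric] T_mat_inverse)
  have "integrable lborel (\<lambda>z. (\<lambda>(x, t). exp (- ((transpose T_mat *v \<omega>) \<bullet> t)) *\<^sub>R g (x, t)) (T_inv_pair z))"
    by (rule integrable_T_inv_pair) (use assms in \<open>auto simp: B_space_def L1_def\<close>)
  also have "(\<lambda>z. (\<lambda>(x, t). exp (- ((transpose T_mat *v \<omega>) \<bullet> t)) *\<^sub>R g (x, t)) (T_inv_pair z))
      = (\<lambda>(x, t). exp (- (\<omega> \<bullet> t)) *\<^sub>R T_inv_op g (x, t))"
    by (auto simp: T_inv_op_def T_inv_pair_def eq)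
  moreover have "AE z in lborel. (\<lambda>(x, t). t \<notin> B_cone \<longrightarrow> g (x, t) = 0) (T_inv_pair z)"
    by (rule AE_T_inv_pair) (use assms in \<open>auto simp: B_space_def\<close>)
  then have "AE (x, t) in lborel. t \<notin> A_cone \<longrightarrow> T_inv_op g (x, t) = 0"
    by eventually_elim (auto simp: T_inv_op_def T_inv_pair_def cone)
  ultimately show ?thesis by (simp add: A_space_def L1_def)
qed

lemma T_op_T_inv_op: "T_op (T_inv_op g) = g"
  by (simp add: T_op_eq)

text \<open>Moving the matrix across the inner products puts its transpose on the frequencies; the
  determinant is 1, so no Jacobian factor appears.\<close>

lemma FL_T_op:
  assumes "f \<in> L1 w"
  shows "FL (T_op f) (transpose T_mat *v k) (transpose T_mat *v s) = FL f k s"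
proof -
  note [measurable] = L1_borel_measurable[OF assms]
  let ?F = "\<lambda>z. exp (- \<i> * of_real (k \<bullet> fst z) - of_real (s \<bullet> snd z)) * f z"
  have "(\<lambda>z. exp (- \<i> * of_real (k \<bullet> fst z) - of_real (s \<bullet> snd z))) \<in> borel_measurable borel"
    by (intro borel_measurable_continuous_onI continuous_intros)
  then have [measurable]: "?F \<in> borel_measurable borel" by measurable
  have "FL (T_op f) (transpose T_mat *v k) (transpose T_mat *v s) = (LINT z|lborel. ?F (T_pair z))"
    unfolding FL_def
    by (intro Bochner_Integration.integral_cong) (auto simp: T_op_def T_pair_def inner_transpose_T_mat)
  also have "\<dots> = (LINT z|lborel. ?F z)" by (rule integral_T_pair) fact
  also have "\<dots> = FL f k s"
    unfolding FL_def by (intro Bochner_Integration.integral_cong) auto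
  finally show ?thesis .
qed

section \<open>Freezing all but the first coordinates\<close>

definition frozen_lborel :: "(('n::{finite,wellorder} \<Rightarrow> real) \<times> ('n \<Rightarrow> real)) measure" where
  "frozen_lborel = rest_lborel \<Otimes>\<^sub>M rest_lborel"

definition embed :: "(('n::{finite,wellorder} \<Rightarrow> real) \<times> ('n \<Rightarrow> real)) \<times> (real \<times> real) \<Rightarrow> (real, 'n) vec \<times> (real, 'n) vec" where
  "embed = (\<lambda>((y, r), (a, b)). (insert_first a y, insert_first b r))"

definition rest_inner :: "(real, 'n::{finite,wellorder}) vec \<Rightarrow> ('n \<Rightarrow> real) \<Rightarrow> real" where
  "rest_inner w y = (\<Sum>i\<in>UNIV - {first}. w $ i * y i)"

lemma slice_eq_embed: "slice f y r = (\<lambda>q. f (embed ((y, r), q)))"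
  by (auto simp: slice_def embed_def)

lemma inner_insert_first: "w \<bullet> insert_first a y = w $ first * a + rest_inner w y"
  unfolding inner_vec_def insert_first_def rest_inner_def
  by (subst sum.remove[of _ first]) (auto intro!: sum.cong)

lemma sigma_finite_rest_lborel: "sigma_finite_measure rest_lborel"
proof -
  interpret product_sigma_finite "\<lambda>_. lborel :: real measure"
    by (simp add: product_sigma_finite_def sigma_finite_lborel)
  show ?thesis unfolding rest_lborel_def by (rule sigma_finite) simp
qed

lemma sigma_finite_frozen_lborel: "sigma_finite_measure frozen_lborel"
  unfolding frozen_lborel_def by (intro sigma_finite_pair_measure sigma_finite_rest_lborel)

lemma emeasure_rest_lborel:
  assumes "\<And>i. A i \<in> sets borel"
  shows "emeasure rest_lborel (Pi\<^sub>E (UNIV - {first}) A) = (\<Prod>i\<in>UNIV - {first}. emeasure lborel (A i))"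
proof -
  interpret product_sigma_finite "\<lambda>_. lborel :: real measure"
    by (simp add: product_sigma_finite_def sigma_finite_lborel)
  show ?thesis unfolding rest_lborel_def using assms by (subst emeasure_PiM) auto
qed

lemma measurable_rest_component [measurable (raw)]:
  assumes "f \<in> M \<rightarrow>\<^sub>M rest_lborel" "i \<noteq> first"
  shows "(\<lambda>x. f x i) \<in> borel_measurable M"
proof -
  have "(\<lambda>y. y i) \<in> rest_lborel \<rightarrow>\<^sub>M (lborel :: real measure)"
    unfolding rest_lborel_def by (rule measurable_component_singleton) (use assms in simp)
  from measurable_compose[OF assms(1) this] show ?thesis by simp
qed

lemma measurable_insert_first:
  assumes "f \<in> borel_measurable M" "g \<in> M \<rightarrow>\<^sub>M rest_lborel"
  shows "(\<lambda>x. insert_first (f x) (g x) :: real^'n::{finite,wellorder}) \<in> borel_measurable M"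
proof (subst borel_measurable_euclidean_space, intro ballI)
  fix b assume "b \<in> (Basis :: (real, 'n) vec set)"
  then obtain i where b: "b = axis i 1" by (auto simp: Basis_vec_def)
  have "(\<lambda>x. insert_first (f x) (g x) \<bullet> b) = (\<lambda>x. if i = first then f x else g x i)"
    by (auto simp: b inner_axis insert_first_def)
  then show "(\<lambda>x. insert_first (f x) (g x) \<bullet> b) \<in> borel_measurable M"
    using assms measurable_rest_component[OF assms(2)] by (cases "i = first") auto
qed

lemma measurable_rest_inner [measurable (raw)]:
  assumes "f \<in> M \<rightarrow>\<^sub>M rest_lborel"
  shows "(\<lambda>x. rest_inner w (f x)) \<in> borel_measurable M"
  unfolding rest_inner_def
  by (intro borel_measurable_sum borel_measurable_times measurable_rest_component[OF assms]) auto

lemma measurable_frozen_fst_snd [measurable]: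
  "fst \<in> frozen_lborel \<rightarrow>\<^sub>M rest_lborel" "snd \<in> frozen_lborel \<rightarrow>\<^sub>M rest_lborel"
  unfolding frozen_lborel_def by measurable

lemma measurable_embed [measurable]: "embed \<in> frozen_lborel \<Otimes>\<^sub>M lborel \<rightarrow>\<^sub>M borel"
proof -
  have "embed = (\<lambda>z. (insert_first (fst (snd z)) (fst (fst z)), insert_first (snd (snd z)) (snd (fst z))))"
    by (auto simp: embed_def)
  also have "\<dots> \<in> frozen_lborel \<Otimes>\<^sub>M (lborel \<Otimes>\<^sub>M lborel) \<rightarrow>\<^sub>M borel \<Otimes>\<^sub>M borel"
    by (intro measurable_Pair measurable_insert_first) (unfold frozen_lborel_def, measurable)
  finally show ?thesis by (simp add: borel_prod lborel_prod)
qed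

text \<open>The map only regroups coordinates, and Lebesgue measure is determined by boxes: the
  preimage of a box is a product of lower-dimensional boxes whose volumes multiply to the same
  value.\<close>

lemma distr_embed: "distr (frozen_lborel \<Otimes>\<^sub>M lborel) borel embed = (lborel :: ((real, 'n::{finite,wellorder}) vec \<times> (real, 'n) vec) measure)"
proof (rule lborel_eqI[symmetric], clarify)
  interpret F: sigma_finite_measure "frozen_lborel :: (('n \<Rightarrow> real) \<times> ('n \<Rightarrow> real)) measure"
    by (rule sigma_finite_frozen_lborel)
  interpret R: sigma_finite_measure "rest_lborel :: ('n \<Rightarrow> real) measure"
    by (rule sigma_finite_rest_lborel)
  fix la lb ua ub :: "(real, 'n) vec"
  assume lu: "\<And>a b. (a, b) \<in> Basis \<Longrightarrow> (la, lb) \<bullet> (a, b) \<le> (ua, ub) \<bullet> (a, b)"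
  have le: "la $ i \<le> ua $ i" "lb $ i \<le> ub $ i" for i
    using lu[of "axis i 1" 0] lu[of 0 "axis i 1"]
    by (auto simp: Basis_prod_def inner_axis Basis_vec_def)
  let ?P = "\<lambda>l u. Pi\<^sub>E (UNIV - {first}) (\<lambda>i. {l $ i<..<u $ i}) :: ('n \<Rightarrow> real) set"
  let ?I = "\<lambda>l u :: (real, 'n) vec. {l $ first<..<u $ first}"
  have P: "?P l u \<in> sets rest_lborel" for l u
    unfolding rest_lborel_def by (rule sets_PiM_I_finite) auto
  have ins: "insert_first a y \<in> box l u \<longleftrightarrow> a \<in> ?I l u \<and> (\<forall>i\<in>UNIV - {first}. y i \<in> {l $ i<..<u $ i})" for a y l u
    by (auto simp: mem_box_cart insert_first_def)
  have box: "box (la, lb) (ua, ub) = box la ua \<times> box lb ub"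
    by (auto simp: box_def Basis_prod_def ball_Un)
  have one: "emeasure rest_lborel (?P l u) * emeasure lborel (?I l u) = emeasure lborel (box l u)"
    if "\<And>i. l $ i \<le> u $ i" for l u :: "(real, 'n) vec"
    using that by (subst emeasure_rest_lborel)
      (auto simp: emeasure_lborel_box_cart prod.remove[of UNIV first] mult.commute)
  have "embed -` box (la, lb) (ua, ub) \<inter> space (frozen_lborel \<Otimes>\<^sub>M lborel) = (?P la ua \<times> ?P lb ub) \<times> (?I la ua \<times> ?I lb ub)"
    (is "?L = ?R")
  proof (intro set_eqI)
    fix z :: "(('n \<Rightarrow> real) \<times> ('n \<Rightarrow> real)) \<times> (real \<times> real)"
    obtain y r a b where z: "z = ((y, r), (a, b))" by (metis surj_pair)
    have "z \<in> ?L \<longleftrightarrow> (insert_first a y \<in> box la ua \<and> insert_first b r \<in> box lb ub)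
        \<and> y \<in> extensional (UNIV - {first}) \<and> r \<in> extensional (UNIV - {first})"
      \<comment> \<open>The insertion ignores the values of \<open>y\<close> and \<open>r\<close> at
        \<open>first\<close>; extensionality, which a product of sets demands, comes from the
        intersection with the space.\<close>
      unfolding z by (simp add: box embed_def space_pair_measure frozen_lborel_def rest_lborel_def space_PiM PiE_iff)
    also have "\<dots> \<longleftrightarrow> z \<in> ?R"
      unfolding ins z mem_Times_iff fst_conv snd_conv PiE_iff by blast
    finally show "z \<in> ?L \<longleftrightarrow> z \<in> ?R" .
  qed
  then have "emeasure (distr (frozen_lborel \<Otimes>\<^sub>M lborel) borel embed) (box (la, lb) (ua, ub))
      = emeasure (frozen_lborel \<Otimes>\<^sub>M lborel) ((?P la ua \<times> ?P lb ub) \<times> (?I la ua \<times> ?I lb ub))"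
    by (subst emeasure_distr) auto
  also have "\<dots> = emeasure frozen_lborel (?P la ua \<times> ?P lb ub) * emeasure lborel (?I la ua \<times> ?I lb ub)"
    by (rule lborel.emeasure_pair_measure_Times) (auto simp: frozen_lborel_def P lborel_prod[symmetric])
  also have "\<dots> = (emeasure rest_lborel (?P la ua) * emeasure rest_lborel (?P lb ub))
       * (emeasure lborel (?I la ua) * emeasure lborel (?I lb ub))"
    unfolding frozen_lborel_def lborel_prod[symmetric]
    by (subst R.emeasure_pair_measure_Times, simp_all add: P lborel.emeasure_pair_measure_Times)
  also have "\<dots> = emeasure lborel (box la ua) * emeasure lborel (box lb ub)"
    using le by (simp add: one[symmetric] mult_ac)
  also have "\<dots> = emeasure (lborel \<Otimes>\<^sub>M lborel) (box la ua \<times> box lb ub)"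
    by (subst lborel.emeasure_pair_measure_Times) auto
  also have "\<dots> = emeasure lborel (box (la, lb) (ua, ub))"
    by (simp only: lborel_prod box)
  also have "\<dots> = ennreal (\<Prod>b\<in>Basis. ((ua, ub) - (la, lb)) \<bullet> b)"
    by (rule emeasure_lborel_box) (use lu in auto)
  finally show "emeasure (distr (frozen_lborel \<Otimes>\<^sub>M lborel) borel embed) (box (la, lb) (ua, ub))
      = ennreal (\<Prod>b\<in>Basis. ((ua, ub) - (la, lb)) \<bullet> b)" .
qed simp

lemma pair_sigma_finite_frozen: "pair_sigma_finite frozen_lborel (lborel :: (real \<times> real) measure)"
  by (simp add: pair_sigma_finite_def sigma_finite_frozen_lborel sigma_finite_lborel)

lemma AE_embed:
  assumes "AE z in lborel. P z"
  shows "AE p in frozen_lborel. AE q in lborel. P (embed (p, q))"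
proof -
  interpret pair_sigma_finite frozen_lborel "lborel :: (real \<times> real) measure" by (rule pair_sigma_finite_frozen)
  have "AE z in frozen_lborel \<Otimes>\<^sub>M lborel. P (embed z)"
    by (rule AE_distrD[of embed "frozen_lborel \<Otimes>\<^sub>M lborel" borel P, unfolded distr_embed, OF measurable_embed assms])
  then show ?thesis by (rule AE_pair)
qed

lemma integrable_embed:
  fixes F :: "(real, 'n::{finite,wellorder}) vec \<times> (real, 'n) vec \<Rightarrow> complex"
  assumes "integrable lborel F"
  shows "integrable (frozen_lborel \<Otimes>\<^sub>M lborel) (\<lambda>z. F (embed z))"
  by (rule integrable_distr[of embed _ borel]) (use assms in \<open>simp_all add: distr_embed\<close>)

lemma integral_embed:
  fixes F :: "(real, 'n::{finite,wellorder}) vec \<times> (real, 'n) vec \<Rightarrow> complex"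
  assumes F: "integrable lborel F"
  shows "(LINT z|lborel. F z) = (LINT p|frozen_lborel. LINT q|lborel. F (embed (p, q)))"
    and "integrable frozen_lborel (\<lambda>p. LINT q|lborel. F (embed (p, q)))"
    and "AE p in frozen_lborel. integrable lborel (\<lambda>q. F (embed (p, q)))"
proof -
  interpret pair_sigma_finite frozen_lborel "lborel :: (real \<times> real) measure" by (rule pair_sigma_finite_frozen)
  have [measurable]: "F \<in> borel_measurable borel" using F by auto
  have "(LINT z|lborel. F z) = (LINT z|(frozen_lborel \<Otimes>\<^sub>M lborel). F (embed z))"
    by (subst distr_embed[symmetric], rule integral_distr) auto
  then show "(LINT z|lborel. F z) = (LINT p|frozen_lborel. LINT q|lborel. F (embed (p, q)))"
    using integral_fst'[OF integrable_embed[OF F]] by simp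
  show "integrable frozen_lborel (\<lambda>p. LINT q|lborel. F (embed (p, q)))"
    by (rule integrable_fst'[OF integrable_embed[OF F]])
  show "AE p in frozen_lborel. integrable lborel (\<lambda>q. F (embed (p, q)))"
    by (rule AE_integrable_fst'[OF integrable_embed[OF F]])
qed

section \<open>The half-plane transform and the symbol\<close>

lemma L1_half_measurable:
  assumes "f \<in> L1_half w"
  shows "(\<lambda>z. indicator (UNIV \<times> {0..}) z *\<^sub>R f z) \<in> borel_measurable (borel :: (real \<times> real) measure)"
proof -
  have "integrable lborel (\<lambda>z. indicator (UNIV \<times> {0..}) z *\<^sub>R (\<lambda>(x, t). exp (- (w * t)) *\<^sub>R f (x, t)) z)"
    using assms by (simp add: L1_half_def set_integrable_def)
  from borel_measurable_integrable[OF this]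
  have "(\<lambda>z. indicator (UNIV \<times> {0..}) z *\<^sub>R (\<lambda>(x, t). exp (- (w * t)) *\<^sub>R f (x, t)) z) \<in> borel_measurable borel"
    by simp
  moreover have "(\<lambda>z :: real \<times> real. exp (w * snd z)) \<in> borel_measurable borel"
    by (intro borel_measurable_continuous_onI continuous_intros)
  ultimately have "(\<lambda>z. exp (w * snd z) *\<^sub>R (indicator (UNIV \<times> {0..}) z *\<^sub>R (\<lambda>(x, t). exp (- (w * t)) *\<^sub>R f (x, t)) z)) \<in> borel_measurable borel"
    by (rule borel_measurable_scaleR[rotated])
  also have "(\<lambda>z. exp (w * snd z) *\<^sub>R (indicator (UNIV \<times> {0..}) z *\<^sub>R (\<lambda>(x, t). exp (- (w * t)) *\<^sub>R f (x, t)) z))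
      = (\<lambda>z. indicator (UNIV \<times> {0..}) z *\<^sub>R f z)"
    by (auto simp: exp_minus)
  finally show ?thesis .
qed

lemma FL_half_altdef:
  "FL_half f k s = (LINT z|lborel. exp (- \<i> * of_real (k * fst z) - of_real (s * snd z)) * (indicator (UNIV \<times> {0..}) z *\<^sub>R f z))"
  unfolding FL_half_def set_lebesgue_integral_def
  by (intro Bochner_Integration.integral_cong) auto

text \<open>Absorbing the weight gives a function that is integrable over the whole plane and leaves
  a kernel with rate \<open>s - w\<close>, bounded by 1 on the half plane when \<open>s\<close> is
  at least \<open>w\<close>.\<close>

definition weighted_half :: "real \<Rightarrow> (real \<times> real \<Rightarrow> complex) \<Rightarrow> real \<times> real \<Rightarrow> complex" where
  "weighted_half w f z = exp (- of_real (w * snd z)) * (indicator (UNIV \<times> {0..}) z *\<^sub>R f z)"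

lemma integrable_weighted_half:
  "f \<in> L1_half w \<Longrightarrow> integrable lborel (weighted_half w f)"
proof -
  assume "f \<in> L1_half w"
  then have "integrable lborel (\<lambda>z. indicator (UNIV \<times> {0..}) z *\<^sub>R (\<lambda>(x, t). exp (- (w * t)) *\<^sub>R f (x, t)) z)"
    by (simp add: L1_half_def set_integrable_def)
  also have "(\<lambda>z. indicator (UNIV \<times> {0..}) z *\<^sub>R (\<lambda>(x, t). exp (- (w * t)) *\<^sub>R f (x, t)) z) = weighted_half w f"
    by (auto simp: weighted_half_def fun_eq_iff scaleR_conv_of_real exp_of_real[symmetric] split: split_indicator)
  finally show ?thesis .
qed

lemma weighted_half_eq_0: "z \<notin> UNIV \<times> {0..} \<Longrightarrow> weighted_half w f z = 0"
  by (simp add: weighted_half_def)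

lemma FL_half_weighted:
  "FL_half f k s = (LINT z|lborel. exp (- \<i> * of_real (k * fst z) - of_real ((s - w) * snd z)) * weighted_half w f z)"
  unfolding FL_half_altdef weighted_half_def
  by (intro Bochner_Integration.integral_cong) (auto simp: exp_add[symmetric] exp_diff exp_minus algebra_simps divide_simps)

lemma norm_FL_kernel_le_1:
  assumes "0 \<le> s" "0 \<le> t"
  shows "norm (exp (- \<i> * of_real (k * x) - of_real (s * t))) \<le> 1"
  using assms by (simp add: norm_exp_eq_Re)

lemma measurable_FL_kernel:
  "(\<lambda>z. exp (- \<i> * of_real (k * fst z) - of_real (s * snd z))) \<in> borel_measurable (borel :: (real \<times> real) measure)"
  by (intro borel_measurable_continuous_onI continuous_intros)

lemma integrable_FL_half:
  assumes "f \<in> L1_half w" "s \<ge> w"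
  shows "integrable lborel (\<lambda>z. exp (- \<i> * of_real (k * fst z) - of_real ((s - w) * snd z)) * weighted_half w f z)"
proof (rule integrable_mult_supported[OF integrable_weighted_half[OF assms(1)], where S="UNIV \<times> {0..}"])
  show "(\<lambda>z. exp (- \<i> * of_real (k * fst z) - of_real ((s - w) * snd z))) \<in> borel_measurable lborel"
    using measurable_FL_kernel[of k "s - w"] by simp
  show "norm (exp (- \<i> * of_real (k * fst z) - of_real ((s - w) * snd z))) \<le> 1" if "z \<in> UNIV \<times> {0..}" for z
    using that assms(2) by (intro norm_FL_kernel_le_1) auto
qed (rule weighted_half_eq_0)

lemma FL_half_sequentially:
  assumes f: "f \<in> L1_half w" and k: "k \<longlonglongrightarrow> k0" and s: "s \<longlonglongrightarrow> s0" and sw: "\<And>n. s n \<ge> w"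
  shows "(\<lambda>n. FL_half f (k n) (s n)) \<longlonglongrightarrow> FL_half f k0 s0"
  unfolding FL_half_weighted[of f _ _ w]
proof (rule integral_dominated_convergence[where w="\<lambda>z. norm (weighted_half w f z)"])
  have s0: "s0 \<ge> w" using LIMSEQ_le_const[OF s] sw by blast
  show "(\<lambda>z. exp (- \<i> * of_real (k0 * fst z) - of_real ((s0 - w) * snd z)) * weighted_half w f z) \<in> borel_measurable lborel"
    by (rule borel_measurable_integrable[OF integrable_FL_half[OF f s0]])
  show "(\<lambda>z. exp (- \<i> * of_real (k n * fst z) - of_real ((s n - w) * snd z)) * weighted_half w f z) \<in> borel_measurable lborel" for n
    by (rule borel_measurable_integrable[OF integrable_FL_half[OF f sw]])
  show "integrable lborel (\<lambda>z. norm (weighted_half w f z))"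
    by (intro integrable_norm integrable_weighted_half f)
  show "AE z in lborel. (\<lambda>n. exp (- \<i> * of_real (k n * fst z) - of_real ((s n - w) * snd z)) * weighted_half w f z)
      \<longlonglongrightarrow> exp (- \<i> * of_real (k0 * fst z) - of_real ((s0 - w) * snd z)) * weighted_half w f z"
    by (intro AE_I2 tendsto_intros k s)
  fix n
  have "norm (exp (- \<i> * of_real (k n * fst z) - of_real ((s n - w) * snd z)) * weighted_half w f z) \<le> norm (weighted_half w f z)" for z
  proof (cases "snd z \<ge> 0")
    case True
    then show ?thesis using norm_FL_kernel_le_1[of "s n - w" "snd z" "k n" "fst z"] sw[of n]
      unfolding norm_mult by (intro mult_left_le_one_le) auto
  next
    case False
    then have "weighted_half w f z = 0" by (intro weighted_half_eq_0) (auto simp: mem_Times_iff)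
    then show ?thesis by simp
  qed
  then show "AE z in lborel. norm (exp (- \<i> * of_real (k n * fst z) - of_real ((s n - w) * snd z)) * weighted_half w f z) \<le> norm (weighted_half w f z)"
    by simp
qed

text \<open>Needed to recognise a given solution h as the representative chosen by
  \<open>Xi\<close>. In the weighted form the equation at \<open>s = w + \<sigma>\<close> is a test
  against a Fourier kernel times a Laplace kernel of rate \<sigma>.\<close>

lemma FL_half_unique:
  assumes f: "f \<in> L1_half w" and h: "h \<in> L1_half w" and eq: "\<And>k s. s > w \<Longrightarrow> FL_half f k s = FL_half h k s"
  shows "AE (a, b) in lborel. b \<ge> 0 \<longrightarrow> f (a, b) = h (a, b)"
proof -
  let ?Fo = "(\<lambda>q x. exp (- \<i> * of_real (q * x))) ` (\<rat> :: real set)"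
  \<comment> \<open>The bound 1 is arbitrary: the equation is available for every \<open>s\<close>
    above \<open>w\<close>, and any interval of rates to the right of 0 suffices.\<close>
  let ?La = "(\<lambda>\<sigma> t. exp (- of_real (\<sigma> * t))) ` (\<rat> \<inter> {0<..<1} :: real set) :: (real \<Rightarrow> complex) set"
  have det: "determining lborel (UNIV \<times> {0..}) ((\<lambda>(e, e') (x, y). e x * e' y) ` (?Fo \<times> ?La))"
    unfolding lborel_prod[symmetric]
    by (intro determining_pair sigma_finite_lborel determining_fourier determining_laplace countable_image countable_rat) simp
  have "AE z in lborel. weighted_half w f z - weighted_half w h z = 0"
  proof (rule determiningD[OF det])
    show "integrable lborel (\<lambda>z. weighted_half w f z - weighted_half w h z)"
      by (intro Bochner_Integration.integrable_diff integrable_weighted_half f h)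
    show "weighted_half w f z - weighted_half w h z = 0" if "z \<notin> UNIV \<times> {0..}" for z
      using weighted_half_eq_0[OF that] by simp
    fix g assume "g \<in> (\<lambda>(e, e') (x, y). e x * e' y) ` (?Fo \<times> ?La)"
    then obtain q \<sigma> :: real where \<sigma>: "\<sigma> > 0"
      and g: "g = (\<lambda>(x, y). exp (- \<i> * of_real (q * x)) * exp (- of_real (\<sigma> * y)))" by auto
    have "(LINT z|lborel. g z * (weighted_half w f z - weighted_half w h z))
        = (LINT z|lborel. exp (- \<i> * of_real (q * fst z) - of_real ((w + \<sigma> - w) * snd z)) * weighted_half w f z
            - exp (- \<i> * of_real (q * fst z) - of_real ((w + \<sigma> - w) * snd z)) * weighted_half w h z)"
      by (intro Bochner_Integration.integral_cong) (auto simp: g exp_diff exp_minus algebra_simps divide_simps)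
    also have "\<dots> = FL_half f q (w + \<sigma>) - FL_half h q (w + \<sigma>)"
      unfolding FL_half_weighted[of _ _ _ w] using \<sigma>
      by (intro Bochner_Integration.integral_diff integrable_FL_half f h) auto
    also have "\<dots> = 0" using eq[of "w + \<sigma>" q] \<sigma> by simp
    finally show "(LINT z|lborel. g z * (weighted_half w f z - weighted_half w h z)) = 0" .
  qed
  then show ?thesis
    by eventually_elim (auto simp: weighted_half_def)
qed

lemma FL_half_cong_AE:
  assumes f: "f \<in> L1_half w" and h: "h \<in> L1_half w" and eq: "AE (a, b) in lborel. b \<ge> 0 \<longrightarrow> f (a, b) = h (a, b)"
  shows "FL_half f k s = FL_half h k s"
  unfolding FL_half_altdef
proof (rule integral_cong_AE)
  show "(\<lambda>z. exp (- \<i> * of_real (k * fst z) - of_real (s * snd z)) * (indicator (UNIV \<times> {0..}) z *\<^sub>R f z)) \<in> borel_measurable lborel"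
    using borel_measurable_times[OF measurable_FL_kernel L1_half_measurable[OF f]] by simp
  show "(\<lambda>z. exp (- \<i> * of_real (k * fst z) - of_real (s * snd z)) * (indicator (UNIV \<times> {0..}) z *\<^sub>R h z)) \<in> borel_measurable lborel"
    using borel_measurable_times[OF measurable_FL_kernel L1_half_measurable[OF h]] by simp
  show "AE z in lborel. exp (- \<i> * of_real (k * fst z) - of_real (s * snd z)) * (indicator (UNIV \<times> {0..}) z *\<^sub>R f z)
     = exp (- \<i> * of_real (k * fst z) - of_real (s * snd z)) * (indicator (UNIV \<times> {0..}) z *\<^sub>R h z)"
    using eq by eventually_elim (auto split: split_indicator)
qed

section \<open>Continuity of the Levy symbol\<close>

lemma set_integral_exp_half_line:
  assumes z: "Re z < 0"
  shows "(LINT u:{0<..}|lborel. exp (of_real u * z)) = - 1 / z"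
proof -
  have z0: "z \<noteq> 0" using z by auto
  have int: "set_integrable lborel {0<..} (\<lambda>u. exp (of_real u * z))"
  proof -
    have meas: "(\<lambda>u. indicator {0<..} u *\<^sub>R exp (of_real u * z)) \<in> borel_measurable lborel" by simp
    show ?thesis unfolding set_integrable_def
      by (rule Bochner_Integration.integrable_bound[OF integrable_I0i_exp_mscale[of "- Re z", unfolded set_integrable_def] meas])
        (use z in \<open>auto split: split_indicator simp: norm_exp_eq_Re\<close>)
  qed
  have "(LBINT u=0..\<infinity>. exp (of_real u * z)) = 0 - 1 / z"
  proof (rule interval_integral_FTC_integrable[where F="\<lambda>u. exp (of_real u * z) / z"])
    fix x :: real
    have "((\<lambda>w. exp (w * z) / z) has_field_derivative exp (of_real x * z)) (at (of_real x))"
      using z0 by (auto intro!: derivative_eq_intros)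
    then show "((\<lambda>u. exp (of_real u * z) / z) has_vector_derivative exp (of_real x * z)) (at x)"
      by (rule has_vector_derivative_real_field)
    show "isCont (\<lambda>u. exp (of_real u * z)) x" by (intro continuous_intros)
  next
    show "set_integrable lborel (einterval 0 \<infinity>) (\<lambda>u. exp (of_real u * z))"
      using int by (simp add: einterval_eq zero_ereal_def)
    have "((\<lambda>u. exp (complex_of_real u * z) / z) \<longlongrightarrow> exp (of_real 0 * z) / z) (at_right 0)"
      by (intro tendsto_intros) (use z0 in auto)
    then show "(((\<lambda>u. exp (complex_of_real u * z) / z) \<circ> real_of_ereal) \<longlongrightarrow> 1 / z) (at_right 0)"
      by (simp add: zero_ereal_def ereal_tendsto_simps)
    have "((\<lambda>u. exp (u * Re z)) \<longlongrightarrow> 0) at_top"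
      using z by real_asymp
    then have "((\<lambda>u. exp (complex_of_real u * z)) \<longlongrightarrow> 0) at_top"
      by (subst tendsto_norm_zero_iff[symmetric]) (simp add: norm_exp_eq_Re)
    from tendsto_divide[OF this tendsto_const z0]
    show "(((\<lambda>u. exp (complex_of_real u * z) / z) \<circ> real_of_ereal) \<longlongrightarrow> 0) (at_left \<infinity>)"
      by (simp add: ereal_tendsto_simps)
  qed simp
  then show ?thesis
    using interval_integral_to_infinity_eq[of lborel 0 "\<lambda>u. exp (of_real u * z)"] by (simp add: zero_ereal_def)
qed

text \<open>The characteristic functions \<open>exp (u * \<xi> k s)\<close> are continuous for each \<open>u\<close>; integrating
  against \<open>exp (- u)\<close> yields the resolvent \<open>1 / (1 - \<xi> k s)\<close>, which avoids choosing a branch of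
  the logarithm.\<close>

lemma levy_symbol_sequentially:
  assumes levy: "levy_subordinator_process M X" and sym: "is_levy_symbol M X \<xi>"
    and k: "k \<longlonglongrightarrow> k0" and s: "s \<longlonglongrightarrow> s0" and s_pos: "\<And>n. 0 \<le> s n"
  shows "(\<lambda>n. \<xi> (k n) (s n)) \<longlonglongrightarrow> \<xi> k0 s0"
proof -
  interpret levy_subordinator_process M X by fact
  define e where "e k s z = exp (\<i> * of_real (k * fst z) - of_real (s * snd z))" for k s and z :: "real \<times> real"
  have s0: "0 \<le> s0" using LIMSEQ_le_const[OF s] s_pos by blast
  have e_meas: "(\<lambda>a. e k s (X u a)) \<in> borel_measurable M" if "u \<ge> 0" for u k s
  proof -
    have "e k s \<in> borel_measurable borel" unfolding e_def
      by (intro borel_measurable_continuous_onI continuous_intros)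
    from measurable_compose[OF measurable_X[OF that] this] show ?thesis .
  qed
  have e_le: "AE a in M. norm (e k s (X u a)) \<le> 1" if "u \<ge> 0" "s \<ge> 0" for u k s
    using second_nonneg[OF that(1)] by eventually_elim (use that in \<open>simp add: e_def norm_exp_eq_Re\<close>)
  have \<xi>: "exp (of_real u * \<xi> k s) = (LINT a|M. e k s (X u a))" if "u \<ge> 0" "s \<ge> 0" for u k s
    using sym that by (simp add: is_levy_symbol_def e_def)
  have norm_le: "norm (exp (of_real u * \<xi> k s)) \<le> 1" if "u \<ge> 0" "s \<ge> 0" for u k s
  proof -
    have "norm (LINT a|M. e k s (X u a)) \<le> (LINT a|M. norm (e k s (X u a)))"
      by (rule integral_norm_bound)
    also have "\<dots> \<le> (LINT a|M. 1)"
      by (rule integral_mono_AE)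
        (use e_le[OF that] e_meas[OF that(1)] in \<open>auto intro!: integrable_const_bound[where B=1]\<close>)
    finally show ?thesis using \<xi>[OF that] by (simp add: prob_space)
  qed
  \<comment> \<open>Subtracting 1 pushes the exponent into the open left half plane: this gives the
    common majorant exp (-u), makes the half-line integral converge, and keeps \<xi> away from
    1.\<close>
  have Re_le: "Re (\<xi> k s) \<le> 0" if "s \<ge> 0" for k s
    using norm_le[of 1 s k] that by (simp add: norm_exp_eq_Re)
  have pointwise: "(\<lambda>n. exp (of_real u * \<xi> (k n) (s n))) \<longlonglongrightarrow> exp (of_real u * \<xi> k0 s0)" if u: "u \<ge> 0" for u
    unfolding \<xi>[OF u s_pos] \<xi>[OF u s0]
  proof (rule integral_dominated_convergence[where w="\<lambda>_. 1"])
    show "AE a in M. (\<lambda>n. e (k n) (s n) (X u a)) \<longlonglongrightarrow> e k0 s0 (X u a)"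
      unfolding e_def by (intro AE_I2 tendsto_intros k s)
  qed (use e_meas[OF u] e_le[OF u s_pos] in auto)
  have "(\<lambda>n. LINT u:{0<..}|lborel. exp (of_real u * (\<xi> (k n) (s n) - 1)))
      \<longlonglongrightarrow> (LINT u:{0<..}|lborel. exp (of_real u * (\<xi> k0 s0 - 1)))"
    unfolding set_lebesgue_integral_def
  proof (rule integral_dominated_convergence[where w="\<lambda>u. indicator {0<..} u *\<^sub>R exp (- (u * 1))"])
    show "integrable lborel (\<lambda>u. indicator {0<..} u *\<^sub>R exp (- (u * 1 :: real)))"
      using integrable_I0i_exp_mscale[of 1] by (simp only: set_integrable_def zero_less_one)
    show "AE u in lborel. (\<lambda>n. indicator {0<..} u *\<^sub>R exp (of_real u * (\<xi> (k n) (s n) - 1)))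
        \<longlonglongrightarrow> indicator {0<..} u *\<^sub>R exp (complex_of_real u * (\<xi> k0 s0 - 1))"
    proof (rule AE_I2)
      fix u :: real
      show "(\<lambda>n. indicator {0<..} u *\<^sub>R exp (of_real u * (\<xi> (k n) (s n) - 1)))
        \<longlonglongrightarrow> indicator {0<..} u *\<^sub>R exp (complex_of_real u * (\<xi> k0 s0 - 1))"
      proof (cases "u > 0")
        case True
        have "exp (of_real u * (z - 1)) = exp (- of_real u) * exp (of_real u * z)" for z :: complex
          by (simp add: exp_add[symmetric] algebra_simps)
        then show ?thesis using True by (auto intro!: tendsto_intros pointwise)
      qed auto
    qed
    show "AE u in lborel. norm (indicator {0<..} u *\<^sub>R exp (complex_of_real u * (\<xi> (k n) (s n) - 1)))
        \<le> indicator {0<..} u *\<^sub>R exp (- (u * 1))" for n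
      using Re_le[OF s_pos[of n], of "k n"]
      by (auto split: split_indicator simp: norm_exp_eq_Re mult_le_0_iff algebra_simps intro!: AE_I2)
  qed auto
  moreover have "(LINT u:{0<..}|lborel. exp (of_real u * (\<xi> k s - 1))) = - 1 / (\<xi> k s - 1)" if "s \<ge> 0" for k s
    by (rule set_integral_exp_half_line) (use Re_le[OF that, of k] in auto)
  ultimately have lim: "(\<lambda>n. - 1 / (\<xi> (k n) (s n) - 1)) \<longlonglongrightarrow> - 1 / (\<xi> k0 s0 - 1)"
    using s_pos s0 by simp
  have "\<xi> k0 s0 \<noteq> 1" using Re_le[OF s0, of k0] by auto
  then have "- 1 / (\<xi> k0 s0 - 1) \<noteq> 0" by simp
  \<comment> \<open>The inverse of -1 / (z - 1) is 1 - z, so subtracting it from 1 gives back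
    z.\<close>
  from tendsto_diff[OF tendsto_const[of 1] tendsto_inverse[OF lim this]] show ?thesis by simp
qed

section \<open>Slices of functions in the transformed space\<close>

lemma rest_inner_cong: "(\<And>i. i \<noteq> first \<Longrightarrow> v $ i = w $ i) \<Longrightarrow> rest_inner v y = rest_inner w y"
  unfolding rest_inner_def by (intro sum.cong) auto

lemma B_space_L1: "g \<in> B_space \<omega> \<Longrightarrow> g \<in> L1 (transpose T_mat *v \<omega>)"
  by (simp add: B_space_def)

text \<open>Only the sign conditions of the cone are kept. Vanishing for negative \<open>b\<close>
  lets the half-plane transform replace the integral over the plane; vanishing for negative frozen
  times provides the support needed by the Laplace kernels.\<close>

lemma B_space_vanish:
  assumes "g \<in> B_space \<omega>"
  shows "AE (y, r) in frozen_lborel. AE (a, b) in lborel.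
    b < 0 \<or> (\<exists>i\<in>UNIV - {first}. r i < 0) \<longrightarrow> slice g y r (a, b) = 0"
proof -
  have "AE (x, t) in lborel. t \<notin> B_cone \<longrightarrow> g (x, t) = 0" using assms by (simp add: B_space_def)
  from AE_embed[OF this]
  have "AE p in frozen_lborel. AE q in lborel. (case embed (p, q) of (x, t) \<Rightarrow> t \<notin> B_cone \<longrightarrow> g (x, t) = 0)"
    by simp
  then show ?thesis
  proof eventually_elim
    case (elim p)
    then show ?case
      unfolding case_prod_beta'
    proof eventually_elim
      case (elim q)
      show ?case
      proof
        assume *: "snd q < 0 \<or> (\<exists>i\<in>UNIV - {first}. snd p i < 0)"
        have "insert_first (snd q) (snd p) \<notin> B_cone"
          using * by (fastforce simp: B_cone_def insert_first_def not_less)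
        then show "slice g (fst p) (snd p) (fst q, snd q) = 0"
          using elim by (simp add: slice_def embed_def split: prod.splits)
      qed
    qed
  qed
qed

text \<open>All time coordinates are nonnegative on the cone, so raising \<open>s\<close> above the
  weight only shrinks the kernel. The non-strict inequality admits the weight itself as
  \<open>s\<close>, which gives integrability of almost every slice.\<close>

lemma B_space_integrable_FL:
  assumes g: "g \<in> B_space \<omega>" and s: "\<And>i. s $ i \<ge> (transpose T_mat *v \<omega>) $ i"
  shows "integrable lborel (\<lambda>z. exp (- \<i> * of_real (k \<bullet> fst z) - of_real (s \<bullet> snd z)) * g z)"
proof (rule Bochner_Integration.integrable_bound)
  let ?w = "transpose T_mat *v \<omega>"
  show "integrable lborel (\<lambda>(x, t). exp (- (?w \<bullet> t)) *\<^sub>R g (x, t))"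
    using B_space_L1[OF g] by (simp add: L1_def)
  have "(\<lambda>z. exp (- \<i> * of_real (k \<bullet> fst z) - of_real (s \<bullet> snd z))) \<in> borel_measurable borel"
    by (intro borel_measurable_continuous_onI continuous_intros)
  from borel_measurable_times[OF this L1_borel_measurable[OF B_space_L1[OF g]]]
  show "(\<lambda>z. exp (- \<i> * of_real (k \<bullet> fst z) - of_real (s \<bullet> snd z)) * g z) \<in> borel_measurable lborel"
    by simp
  have "AE (x, t) in lborel. t \<notin> B_cone \<longrightarrow> g (x, t) = 0" using g by (simp add: B_space_def)
  then show "AE z in lborel. norm (exp (- \<i> * of_real (k \<bullet> fst z) - of_real (s \<bullet> snd z)) * g z)
      \<le> norm (case z of (x, t) \<Rightarrow> exp (- (?w \<bullet> t)) *\<^sub>R g (x, t))"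
  proof eventually_elim
    case (elim z)
    obtain x t where z: "z = (x, t)" by fastforce
    show ?case
    proof (cases "t \<in> B_cone")
      case True
      then have "0 \<le> t $ i" for i by (cases "i = first") (auto simp: B_cone_def)
      then have "?w \<bullet> t \<le> s \<bullet> t" unfolding inner_vec_def using s by (auto intro!: sum_mono mult_right_mono)
      then show ?thesis
        by (auto simp: z norm_mult norm_exp_eq_Re intro!: mult_right_mono)
    next
      case False
      then have "g z = 0" using elim unfolding z by simp
      then show ?thesis by simp
    qed
  qed
qed

lemma B_space_slices:
  assumes g: "g \<in> B_space \<omega>"
  shows "AE (y, r) in frozen_lborel. slice g y r \<in> L1_half (\<Sum>i\<in>UNIV. \<omega> $ i)"
proof -
  let ?w = "transpose T_mat *v \<omega>"
  have "integrable lborel (\<lambda>z. exp (- \<i> * of_real (0 \<bullet> fst z) - of_real (?w \<bullet> snd z)) * g z)"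
    by (rule B_space_integrable_FL[OF g]) simp
  from integral_embed(3)[OF this]
  show ?thesis
  proof eventually_elim
    case (elim p)
    obtain y r where p: "p = (y, r)" by fastforce
    have "integrable lborel (\<lambda>q. of_real (exp (rest_inner ?w r)) *
        (exp (- \<i> * of_real (0 \<bullet> fst (embed (p, q))) - of_real (?w \<bullet> snd (embed (p, q)))) * g (embed (p, q))))"
      by (intro integrable_mult_right elim)
    also have "(\<lambda>q. of_real (exp (rest_inner ?w r)) *
        (exp (- \<i> * of_real (0 \<bullet> fst (embed (p, q))) - of_real (?w \<bullet> snd (embed (p, q)))) * g (embed (p, q))))
      = (\<lambda>(x, t). exp (- ((\<Sum>i\<in>UNIV. \<omega> $ i) * t)) *\<^sub>R slice g y r (x, t))"
      unfolding slice_eq_embed p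
      by (auto simp: fun_eq_iff embed_def inner_insert_first transpose_T_mat_mult_nth scaleR_conv_of_real
          exp_of_real[symmetric] exp_add[symmetric] mult.assoc[symmetric] simp del: mult.assoc)
    finally have "set_integrable lborel (UNIV \<times> {0..}) (\<lambda>(x, t). exp (- ((\<Sum>i\<in>UNIV. \<omega> $ i) * t)) *\<^sub>R slice g y r (x, t))"
      unfolding set_integrable_def by (rule integrable_mult_indicator[rotated]) (simp add: lborel_prod[symmetric])
    then show ?case by (simp add: p L1_half_def)
  qed
qed

lemma FL_eq_frozen_integral:
  fixes \<omega> :: "real^'n::{finite,wellorder}"
  assumes g: "g \<in> B_space \<omega>" and s: "\<And>i. s $ i \<ge> (transpose T_mat *v \<omega>) $ i"
  shows "FL g k s = (LINT p|frozen_lborel. exp (- \<i> * of_real (rest_inner k (fst p)) - of_real (rest_inner s (snd p)))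
            * FL_half (slice g (fst p) (snd p)) (k $ first) (s $ first))"
    and "integrable frozen_lborel (\<lambda>p. exp (- \<i> * of_real (rest_inner k (fst p)) - of_real (rest_inner s (snd p)))
            * FL_half (slice g (fst p) (snd p)) (k $ first) (s $ first))"
proof -
  let ?H = "\<lambda>z. exp (- \<i> * of_real (k \<bullet> fst z) - of_real (s \<bullet> snd z)) * g z"
  let ?K = "\<lambda>p. exp (- \<i> * of_real (rest_inner k (fst p)) - of_real (rest_inner s (snd p)))"
  let ?E = "\<lambda>q. exp (- \<i> * of_real (k $ first * fst q) - of_real (s $ first * snd q))"
  have H: "integrable lborel ?H" by (rule B_space_integrable_FL[OF g s])
  note [measurable] = L1_borel_measurable[OF B_space_L1[OF g]]
  have ind[measurable]: "(indicator (UNIV \<times> {0..}) :: real \<times> real \<Rightarrow> real) \<in> borel_measurable borel"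
    by (rule borel_measurable_indicator, rule borel_closed, intro closed_Times closed_UNIV closed_atLeast)
  have E[measurable]: "?E \<in> borel_measurable borel" by (rule measurable_FL_kernel)
  have slice_embed: "?H (embed (p, q)) = ?K p * (?E q * slice g (fst p) (snd p) q)" for p q
    by (cases p; cases q)
      (simp add: slice_def embed_def inner_insert_first exp_add[symmetric] algebra_simps exp_diff exp_minus divide_simps)
  have eq: "AE p in frozen_lborel. (LINT q|lborel. ?H (embed (p, q))) = ?K p * FL_half (slice g (fst p) (snd p)) (k $ first) (s $ first)"
    using B_space_vanish[OF g] AE_space
  proof eventually_elim
    case (elim p)
    have [measurable]: "(\<lambda>q. g (embed (p, q))) \<in> borel_measurable borel"
    proof -
      have "(\<lambda>z. g (embed z)) \<in> borel_measurable (frozen_lborel \<Otimes>\<^sub>M lborel)" by measurable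
      from measurable_Pair2[OF this elim(2)] show ?thesis by simp
    qed
    have "(LINT q|lborel. ?H (embed (p, q))) = ?K p * (LINT q|lborel. ?E q * slice g (fst p) (snd p) q)"
      unfolding slice_embed by simp
    \<comment> \<open>Almost every slice vanishes for negative time, so cutting off to the half
      plane does not change the integral.\<close>
    also have "(LINT q|lborel. ?E q * slice g (fst p) (snd p) q)
        = (LINT q|lborel. ?E q * (indicator (UNIV \<times> {0..}) q *\<^sub>R slice g (fst p) (snd p) q))"
    proof (rule integral_cong_AE)
      have sl: "slice g (fst p) (snd p) = (\<lambda>q. g (embed (p, q)))" by (simp add: slice_eq_embed)
      show "(\<lambda>q. ?E q * slice g (fst p) (snd p) q) \<in> borel_measurable lborel"
        unfolding sl measurable_lborel2 by (intro borel_measurable_times E) measurable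
      show "(\<lambda>q. ?E q * (indicator (UNIV \<times> {0..}) q *\<^sub>R slice g (fst p) (snd p) q)) \<in> borel_measurable lborel"
        unfolding sl measurable_lborel2 by (intro borel_measurable_times E borel_measurable_scaleR ind) measurable
      show "AE q in lborel. ?E q * slice g (fst p) (snd p) q = ?E q * (indicator (UNIV \<times> {0..}) q *\<^sub>R slice g (fst p) (snd p) q)"
        using elim(1) unfolding case_prod_beta'
        by eventually_elim (auto split: split_indicator simp: mem_Times_iff not_le)
    qed
    also have "\<dots> = FL_half (slice g (fst p) (snd p)) (k $ first) (s $ first)"
      by (rule FL_half_altdef[symmetric])
    finally show ?case .
  qed
  \<comment> \<open>Measurability is proved directly: it does not follow from almost everywhere
    equality with the measurable partial integral of \<open>?H\<close>, since the measure need not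
    be complete.\<close>
  have meas: "(\<lambda>p. ?K p * FL_half (slice g (fst p) (snd p)) (k $ first) (s $ first)) \<in> borel_measurable frozen_lborel"
  proof (rule borel_measurable_times)
    show "?K \<in> borel_measurable frozen_lborel" by measurable
    have "(\<lambda>z. (?E (snd z) * (indicator (UNIV \<times> {0..}) (snd z) *\<^sub>R g (embed z)))) \<in> borel_measurable (frozen_lborel \<Otimes>\<^sub>M lborel)"
    proof (intro borel_measurable_times borel_measurable_scaleR)
      show "(\<lambda>z. ?E (snd z)) \<in> borel_measurable (frozen_lborel \<Otimes>\<^sub>M lborel)"
        by (rule measurable_compose[OF measurable_snd]) (use E in simp)
      show "(\<lambda>z. indicator (UNIV \<times> {0..} :: (real \<times> real) set) (snd z) :: real) \<in> borel_measurable (frozen_lborel \<Otimes>\<^sub>M lborel)"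
        by (rule measurable_compose[OF measurable_snd]) (unfold measurable_lborel2, rule ind)
      show "(\<lambda>z. g (embed z)) \<in> borel_measurable (frozen_lborel \<Otimes>\<^sub>M lborel)"
        by (rule measurable_compose[OF measurable_embed L1_borel_measurable[OF B_space_L1[OF g]]])
    qed
    from lborel.borel_measurable_lebesgue_integral[of "\<lambda>p q. ?E q * (indicator (UNIV \<times> {0..}) q *\<^sub>R g (embed (p, q)))" frozen_lborel]
      this
    show "(\<lambda>p. FL_half (slice g (fst p) (snd p)) (k $ first) (s $ first)) \<in> borel_measurable frozen_lborel"
      unfolding FL_half_altdef slice_eq_embed by (simp add: case_prod_beta')
  qed
  have "FL g k s = (LINT z|lborel. ?H z)"
    unfolding FL_def by (intro Bochner_Integration.integral_cong) auto
  also have "\<dots> = (LINT p|frozen_lborel. LINT q|lborel. ?H (embed (p, q)))"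
    by (rule integral_embed(1)[OF H])
  also have "\<dots> = (LINT p|frozen_lborel. ?K p * FL_half (slice g (fst p) (snd p)) (k $ first) (s $ first))"
    by (rule integral_cong_AE[OF _ meas eq]) (rule borel_measurable_integrable[OF integral_embed(2)[OF H]])
  finally show "FL g k s = (LINT p|frozen_lborel. ?K p * FL_half (slice g (fst p) (snd p)) (k $ first) (s $ first))" .
  show "integrable frozen_lborel (\<lambda>p. ?K p * FL_half (slice g (fst p) (snd p)) (k $ first) (s $ first))"
    by (rule integrable_cong_AE_imp[OF integral_embed(2)[OF H] meas]) (use eq in eventually_elim, simp)
qed

text \<open>Solves for the original frequencies: the transpose adds all entries into the first one,
  so the first entry has to give up the sum of the others.\<close>

lemma transpose_T_mat_preimage:
  fixes k :: "real^'n::{finite,wellorder}"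
  defines "k' \<equiv> (\<chi> i. if i = first then k $ first - (\<Sum>j\<in>UNIV - {first}. k $ j) else k $ i)"
  shows "transpose T_mat *v k' = k" "(\<Sum>i\<in>UNIV. k' $ i) = k $ first"
proof -
  have "(\<Sum>i\<in>UNIV. k' $ i) = k' $ first + (\<Sum>i\<in>UNIV - {first}. k' $ i)"
    by (subst sum.remove[of _ first]) auto
  also have "(\<Sum>i\<in>UNIV - {first}. k' $ i) = (\<Sum>i\<in>UNIV - {first}. k $ i)"
    by (intro sum.cong) (auto simp: k'_def)
  finally show sum: "(\<Sum>i\<in>UNIV. k' $ i) = k $ first" by (simp add: k'_def)
  show "transpose T_mat *v k' = k"
    by (auto simp: vec_eq_iff transpose_T_mat_mult_nth sum) (simp add: k'_def)
qed

lemma A_hat_transpose_T_mat: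
  assumes "s \<in> A_hat \<omega>"
  shows "(transpose T_mat *v s) $ i > (transpose T_mat *v \<omega>) $ i"
  using assms by (auto simp: A_hat_def transpose_T_mat_mult_nth intro!: sum_strict_mono)

section \<open>From the slicewise equation to the global one\<close>

lemma Xi_rel_slices:
  assumes "Xi_B_rel \<xi> \<omega> g h" and g: "g \<in> B_space \<omega>"
  shows "AE p in frozen_lborel. \<forall>k. \<forall>s > (\<Sum>i\<in>UNIV. \<omega> $ i).
    \<xi> (- k) s * FL_half (slice g (fst p) (snd p)) k s = FL_half (slice h (fst p) (snd p)) k s"
proof -
  let ?w = "\<Sum>i\<in>UNIV. \<omega> $ i"
  have h: "h \<in> B_space \<omega>"
    and rel: "AE (y, r) in frozen_lborel. slice g y r \<in> Xi_dom \<xi> ?w \<and>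
      (AE (a, b) in lborel. b \<ge> 0 \<longrightarrow> slice h y r (a, b) = Xi \<xi> ?w (slice g y r) (a, b))"
    using assms(1) unfolding Xi_B_rel_def frozen_lborel_def by blast+
  from rel B_space_slices[OF h] show ?thesis
    unfolding case_prod_beta'
  proof eventually_elim
    case (elim p)
    then have "\<exists>h. Xi_rel \<xi> ?w (slice g (fst p) (snd p)) h" by (simp add: Xi_dom_def)
    then have Xi: "Xi_rel \<xi> ?w (slice g (fst p) (snd p)) (Xi \<xi> ?w (slice g (fst p) (snd p)))"
      unfolding Xi_def by (rule someI_ex)
    \<comment> \<open>The slice of \<open>h\<close> agrees with the chosen representative only
      almost everywhere and only for nonnegative times; the half-plane transform sees no more than
      that.\<close>
    have "FL_half (slice h (fst p) (snd p)) k s = FL_half (Xi \<xi> ?w (slice g (fst p) (snd p))) k s" for k s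
      by (rule FL_half_cong_AE) (use elim Xi in \<open>auto simp: Xi_rel_def case_prod_beta'\<close>)
    then show ?case using Xi by (simp add: Xi_rel_def)
  qed
qed

lemma Xi_B_rel_FL:
  assumes rel: "Xi_B_rel \<xi> \<omega> g h" and g: "g \<in> B_space \<omega>"
    and s: "\<And>i. s $ i > (transpose T_mat *v \<omega>) $ i"
  shows "FL h k s = \<xi> (- (k $ first)) (s $ first) * FL g k s"
proof -
  let ?K = "\<lambda>p. exp (- \<i> * of_real (rest_inner k (fst p)) - of_real (rest_inner s (snd p)))"
  have h: "h \<in> B_space \<omega>" using rel by (simp add: Xi_B_rel_def)
  have s': "s $ i \<ge> (transpose T_mat *v \<omega>) $ i" for i using s less_imp_le by blast
  have s1: "s $ first > (\<Sum>i\<in>UNIV. \<omega> $ i)" using s[of first] by (simp add: transpose_T_mat_mult_nth)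
  note g_FL = FL_eq_frozen_integral[OF g s', where k=k]
  note h_FL = FL_eq_frozen_integral[OF h s', where k=k]
  have "FL h k s = (LINT p|frozen_lborel. \<xi> (- (k $ first)) (s $ first) * (?K p * FL_half (slice g (fst p) (snd p)) (k $ first) (s $ first)))"
    unfolding h_FL(1)
  proof (rule integral_cong_AE)
    show "AE p in frozen_lborel. ?K p * FL_half (slice h (fst p) (snd p)) (k $ first) (s $ first)
      = \<xi> (- (k $ first)) (s $ first) * (?K p * FL_half (slice g (fst p) (snd p)) (k $ first) (s $ first))"
      using Xi_rel_slices[OF rel g]
    proof eventually_elim
      case (elim p)
      then have "FL_half (slice h (fst p) (snd p)) (k $ first) (s $ first)
          = \<xi> (- (k $ first)) (s $ first) * FL_half (slice g (fst p) (snd p)) (k $ first) (s $ first)"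
        using s1 by simp
      then show ?case by (simp only: mult.left_commute)
    qed
  qed (use g_FL(2) h_FL(2) in auto)
  also have "\<dots> = \<xi> (- (k $ first)) (s $ first) * FL g k s"
    unfolding g_FL(1) by simp
  finally show ?thesis .
qed

section \<open>From the global equation to the slicewise one\<close>

lemma determining_frozen:
  assumes "\<delta> > 0"
  shows "determining (frozen_lborel :: (('n::{finite,wellorder} \<Rightarrow> real) \<times> ('n \<Rightarrow> real)) measure)
    (UNIV \<times> {r. \<forall>i\<in>UNIV - {first}. 0 \<le> r i})
    {e. \<exists>q \<sigma>. (\<forall>i\<in>UNIV - {first}. 0 < \<sigma> i \<and> \<sigma> i < \<delta>) \<and>
      e = (\<lambda>p. exp (- \<i> * of_real (rest_inner (vec_lambda q) (fst p)) - of_real (rest_inner (vec_lambda \<sigma>) (snd p))))}"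
    (is "determining _ ?S ?E")
proof -
  let ?J = "UNIV - {first :: 'n}"
  let ?Fo = "(\<lambda>q x. exp (- \<i> * of_real (q * x))) ` (\<rat> :: real set)"
  let ?La = "(\<lambda>\<sigma> t. exp (- of_real (\<sigma> * t))) ` (\<rat> \<inter> {0<..<\<delta>} :: real set) :: (real \<Rightarrow> complex) set"
  let ?\<Pi> = "\<lambda>E :: (real \<Rightarrow> complex) set. (\<lambda>e x. \<Prod>i\<in>?J. e i (x i)) ` (?J \<rightarrow>\<^sub>E E)"
  have cFo: "countable ?Fo" by (intro countable_image countable_rat)
  have cLa: "countable ?La" by (intro countable_image) (auto intro: countable_rat)
  have det: "determining (frozen_lborel :: (('n \<Rightarrow> real) \<times> ('n \<Rightarrow> real)) measure)
     ({x. \<forall>i\<in>?J. x i \<in> UNIV} \<times> {x. \<forall>i\<in>?J. x i \<in> {0..}}) ((\<lambda>(e, e') (x, y). e x * e' y) ` (?\<Pi> ?Fo \<times> ?\<Pi> ?La))"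
    unfolding frozen_lborel_def
  proof (rule determining_pair[OF sigma_finite_rest_lborel sigma_finite_rest_lborel])
    show "countable (?\<Pi> ?Fo)" by (rule countable_image, rule countable_PiE) (use cFo in auto)
    show "determining rest_lborel {x. \<forall>i\<in>?J. x i \<in> UNIV} (?\<Pi> ?Fo)"
      unfolding rest_lborel_def
      by (rule determining_PiM[OF sigma_finite_lborel cFo determining_fourier]) simp
    show "determining rest_lborel {x. \<forall>i\<in>?J. x i \<in> {0..}} (?\<Pi> ?La)"
      unfolding rest_lborel_def
      by (rule determining_PiM[OF sigma_finite_lborel cLa determining_laplace[OF assms]]) simp
  qed
  \<comment> \<open>Products with rational parameters already determine. Enlarging the family to
    real parameters keeps this property once measurability and the bound are checked for the new
    members, and frees later steps from tracking rationality.\<close>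
  have sub: "(\<lambda>(e, e') (x, y). e x * e' y) ` (?\<Pi> ?Fo \<times> ?\<Pi> ?La) \<subseteq> ?E"
  proof (clarify)
    fix e e' assume e: "e \<in> ?J \<rightarrow>\<^sub>E ?Fo" and e': "e' \<in> ?J \<rightarrow>\<^sub>E ?La"
    have "\<forall>i\<in>?J. \<exists>q. e i = (\<lambda>x. exp (- \<i> * of_real (q * x)))" using e by (fastforce simp: PiE_iff)
    then obtain q where q: "\<And>i. i \<in> ?J \<Longrightarrow> e i = (\<lambda>x. exp (- \<i> * of_real (q i * x)))" by metis
    have "\<forall>i\<in>?J. \<exists>\<sigma>. 0 < \<sigma> \<and> \<sigma> < \<delta> \<and> e' i = (\<lambda>t. exp (- of_real (\<sigma> * t)))" using e' by (fastforce simp: PiE_iff)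
    then obtain \<sigma> where \<sigma>: "\<And>i. i \<in> ?J \<Longrightarrow> 0 < \<sigma> i \<and> \<sigma> i < \<delta> \<and> e' i = (\<lambda>t. exp (- of_real (\<sigma> i * t)))" by metis
    have 1: "(\<Prod>i\<in>?J. e i (x i)) = exp (- \<i> * of_real (rest_inner (vec_lambda q) x))" for x
    proof -
      have "(\<Prod>i\<in>?J. e i (x i)) = (\<Prod>i\<in>?J. exp (- \<i> * of_real (q i * x i)))" using q by (intro prod.cong) auto
      also have "\<dots> = exp (\<Sum>i\<in>?J. - \<i> * of_real (q i * x i))" by (rule exp_sum[symmetric]) simp
      finally show ?thesis by (simp add: rest_inner_def sum_distrib_left sum_negf)
    qed
    have 2: "(\<Prod>i\<in>?J. e' i (x i)) = exp (- of_real (rest_inner (vec_lambda \<sigma>) x))" for x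
    proof -
      have "(\<Prod>i\<in>?J. e' i (x i)) = (\<Prod>i\<in>?J. exp (- of_real (\<sigma> i * x i)))" using \<sigma> by (intro prod.cong) auto
      also have "\<dots> = exp (\<Sum>i\<in>?J. - of_real (\<sigma> i * x i))" by (rule exp_sum[symmetric]) simp
      finally show ?thesis by (simp add: rest_inner_def sum_negf)
    qed
    show "\<exists>q \<sigma>. (\<forall>i\<in>?J. 0 < \<sigma> i \<and> \<sigma> i < \<delta>) \<and>
      (\<lambda>(x, y). (\<Prod>i\<in>?J. e i (x i)) * (\<Prod>i\<in>?J. e' i (y i)))
       = (\<lambda>p. exp (- \<i> * of_real (rest_inner (vec_lambda q) (fst p)) - of_real (rest_inner (vec_lambda \<sigma>) (snd p))))"
    proof (rule exI[of _ q], rule exI[of _ \<sigma>], rule conjI)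
      show "\<forall>i\<in>?J. 0 < \<sigma> i \<and> \<sigma> i < \<delta>" using \<sigma> by blast
      show "(\<lambda>(x, y). (\<Prod>i\<in>?J. e i (x i)) * (\<Prod>i\<in>?J. e' i (y i)))
       = (\<lambda>p. exp (- \<i> * of_real (rest_inner (vec_lambda q) (fst p)) - of_real (rest_inner (vec_lambda \<sigma>) (snd p))))"
        unfolding 1 2 by (simp add: fun_eq_iff exp_add[symmetric])
    qed
  qed
  have E: "e \<in> borel_measurable frozen_lborel \<and> (\<forall>p\<in>space frozen_lborel \<inter> ?S. norm (e p) \<le> 1)" if eE: "e \<in> ?E" for e
  proof -
    obtain q \<sigma> where \<sigma>: "\<forall>i\<in>?J. 0 < \<sigma> i \<and> \<sigma> i < \<delta>"
      and e: "e = (\<lambda>p. exp (- \<i> * of_real (rest_inner (vec_lambda q) (fst p)) - of_real (rest_inner (vec_lambda \<sigma>) (snd p))))"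
      using eE by blast
    have "e \<in> borel_measurable frozen_lborel" unfolding e by measurable
    moreover have "norm (e p) \<le> 1" if "p \<in> ?S" for p
    proof -
      have "0 \<le> rest_inner (vec_lambda \<sigma>) (snd p)"
        unfolding rest_inner_def using that \<sigma> by (intro sum_nonneg) (auto simp: mem_Times_iff less_imp_le)
      then show ?thesis by (simp add: e norm_exp_eq_Re)
    qed
    ultimately show ?thesis by blast
  qed
  have S: "{x. \<forall>i\<in>?J. x i \<in> UNIV} \<times> {x. \<forall>i\<in>?J. x i \<in> {0..}} = ?S"
    by (simp only: UNIV_I atLeast_iff ball_triv) simp
  show ?thesis
    unfolding determining_def
  proof (rule conjI, rule ballI, erule E, intro allI impI)
    fix F assume F: "integrable frozen_lborel F" and F0: "\<forall>p. p \<notin> ?S \<longrightarrow> F p = 0"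
      and I: "\<forall>e\<in>?E. (LINT p|frozen_lborel. e p * F p) = 0"
    show "AE p in frozen_lborel. F p = 0"
    proof (rule determiningD[OF det[unfolded S] F])
      show "F p = 0" if "p \<notin> ?S" for p using F0 that by blast
    next
      fix e assume "e \<in> (\<lambda>(e, e') (x, y). e x * e' y) ` (?\<Pi> ?Fo \<times> ?\<Pi> ?La)"
      then show "(LINT p|frozen_lborel. e p * F p) = 0" by (rule bspec[OF I subsetD[OF sub]])
    qed
  qed
qed

text \<open>The two conditions in \<open>eq\<close> describe the image of \<open>A_hat\<close> under
  the transposed matrix. The exceptional null set here depends on \<open>k1\<close> and
  \<open>s1\<close>.\<close>

lemma slices_symbol_eq_zero:
  fixes \<omega> :: "real^'n::{finite,wellorder}"
  assumes g: "g \<in> B_space \<omega>" and h: "h \<in> B_space \<omega>"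
    and eq: "\<And>k s. \<forall>i. i \<noteq> first \<longrightarrow> s $ i > \<omega> $ i \<Longrightarrow> s $ first - (\<Sum>i\<in>UNIV - {first}. s $ i) > \<omega> $ first \<Longrightarrow>
      \<xi> (- (k $ first)) (s $ first) * FL g k s = FL h k s"
    and s1: "s1 > (\<Sum>i\<in>UNIV. \<omega> $ i)"
  shows "AE p in frozen_lborel. \<xi> (- k1) s1 * FL_half (slice g (fst p) (snd p)) k1 s1 = FL_half (slice h (fst p) (snd p)) k1 s1"
proof -
  let ?w = "\<Sum>i\<in>UNIV. \<omega> $ i" and ?J = "UNIV - {first :: 'n}"
  let ?S = "UNIV \<times> {r :: 'n \<Rightarrow> real. \<forall>i\<in>?J. 0 \<le> r i}"
  \<comment> \<open>The n - 1 frozen increments below \<delta> must add up to strictly less than the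
    slack \<open>s1 - ?w\<close>. Dividing by n ensures this and also makes sense for n = 1.\<close>
  define \<delta> where "\<delta> = (s1 - ?w) / real CARD('n)"
  have \<delta>: "\<delta> > 0" using s1 by (simp add: \<delta>_def)
  define \<Delta> where "\<Delta> p = \<xi> (- k1) s1 * FL_half (slice g (fst p) (snd p)) k1 s1 - FL_half (slice h (fst p) (snd p)) k1 s1" for p
  define W where "W p = exp (- complex_of_real (rest_inner \<omega> (snd p)))" for p :: "('n \<Rightarrow> real) \<times> ('n \<Rightarrow> real)"
  have int: "integrable frozen_lborel (\<lambda>p. exp (- \<i> * of_real (rest_inner (vec_lambda q) (fst p)) - of_real (rest_inner (vec_lambda \<sigma>) (snd p))) * (W p * \<Delta> p))"
    and lint: "(LINT p|frozen_lborel. exp (- \<i> * of_real (rest_inner (vec_lambda q) (fst p)) - of_real (rest_inner (vec_lambda \<sigma>) (snd p))) * (W p * \<Delta> p))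
       = \<xi> (- k1) s1 * FL g (\<chi> i. if i = first then k1 else q i) (\<chi> i. if i = first then s1 else \<omega> $ i + \<sigma> i)
        - FL h (\<chi> i. if i = first then k1 else q i) (\<chi> i. if i = first then s1 else \<omega> $ i + \<sigma> i)"
    if \<sigma>: "\<And>i. i \<in> ?J \<Longrightarrow> 0 \<le> \<sigma> i" for q \<sigma>
  proof -
    let ?k = "(\<chi> i. if i = first then k1 else q i) :: (real, 'n) vec"
    let ?s = "(\<chi> i. if i = first then s1 else \<omega> $ i + \<sigma> i) :: (real, 'n) vec"
    let ?K = "\<lambda>p. exp (- \<i> * of_real (rest_inner ?k (fst p)) - of_real (rest_inner ?s (snd p)))"
    have s: "?s $ i \<ge> (transpose T_mat *v \<omega>) $ i" for i
      using s1 \<sigma>[of i] by (auto simp: transpose_T_mat_mult_nth)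
    note G = FL_eq_frozen_integral[OF g s, where k="?k"]
    note H = FL_eq_frozen_integral[OF h s, where k="?k"]
    have "rest_inner ?k (fst p) = rest_inner (vec_lambda q) (fst p)" for p :: "('n \<Rightarrow> real) \<times> ('n \<Rightarrow> real)"
      by (rule rest_inner_cong) simp
    moreover have "rest_inner ?s (snd p) = rest_inner \<omega> (snd p) + rest_inner (vec_lambda \<sigma>) (snd p)" for p :: "('n \<Rightarrow> real) \<times> ('n \<Rightarrow> real)"
      unfolding rest_inner_def sum.distrib[symmetric] by (intro sum.cong) (auto simp: distrib_right)
    ultimately have eq: "exp (- \<i> * of_real (rest_inner (vec_lambda q) (fst p)) - of_real (rest_inner (vec_lambda \<sigma>) (snd p))) * (W p * \<Delta> p)
        = \<xi> (- k1) s1 * (?K p * FL_half (slice g (fst p) (snd p)) (?k $ first) (?s $ first))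
          - ?K p * FL_half (slice h (fst p) (snd p)) (?k $ first) (?s $ first)" for p
      by (simp add: W_def \<Delta>_def algebra_simps exp_add exp_diff exp_minus divide_simps)
    show "integrable frozen_lborel (\<lambda>p. exp (- \<i> * of_real (rest_inner (vec_lambda q) (fst p)) - of_real (rest_inner (vec_lambda \<sigma>) (snd p))) * (W p * \<Delta> p))"
      unfolding eq by (intro Bochner_Integration.integrable_diff integrable_mult_right G(2) H(2))
    show "(LINT p|frozen_lborel. exp (- \<i> * of_real (rest_inner (vec_lambda q) (fst p)) - of_real (rest_inner (vec_lambda \<sigma>) (snd p))) * (W p * \<Delta> p))
       = \<xi> (- k1) s1 * FL g ?k ?s - FL h ?k ?s"
      unfolding eq G(1) H(1)
      by (subst Bochner_Integration.integral_diff[OF integrable_mult_right[OF G(2)] H(2)]) simp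
  qed
  \<comment> \<open>This is the case of zero frequencies and zero rates, the reason for admitting
    \<sigma> = 0 above.\<close>
  have int0: "integrable frozen_lborel (\<lambda>p. W p * \<Delta> p)"
    using int[of "\<lambda>_. 0" "\<lambda>_. 0"] by (simp add: rest_inner_def)
  have S_sets: "{p \<in> space frozen_lborel. p \<in> ?S} \<in> sets frozen_lborel"
  proof -
    have "{p \<in> space frozen_lborel. \<forall>i\<in>?J. 0 \<le> snd p i} \<in> sets (frozen_lborel :: (('n \<Rightarrow> real) \<times> ('n \<Rightarrow> real)) measure)"
      by measurable
    then show ?thesis by (simp add: mem_Times_iff)
  qed
  have vanish: "AE p in frozen_lborel. p \<notin> ?S \<longrightarrow> \<Delta> p = 0"
  proof -
    have "FL_half f k1 s1 = 0" if "AE q in lborel. f q = 0" "f \<in> L1_half ?w" for f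
    proof -
      have "FL_half f k1 s1 = FL_half (\<lambda>_. 0) k1 s1"
        by (rule FL_half_cong_AE[OF that(2), of "\<lambda>_. 0"])
          (use that(1) in \<open>auto simp: L1_half_def set_integrable_def case_prod_beta' elim!: eventually_mono\<close>)
      then show ?thesis by (simp add: FL_half_altdef)
    qed
    note zero = this
    show ?thesis
      using B_space_vanish[OF g] B_space_vanish[OF h] B_space_slices[OF g] B_space_slices[OF h]
      unfolding case_prod_beta'
    proof eventually_elim
      case (elim p)
      show ?case
      proof
        assume "p \<notin> ?S"
        then have "\<exists>i\<in>?J. snd p i < 0" by (auto simp: mem_Times_iff not_le)
        then have "AE q in lborel. slice g (fst p) (snd p) q = 0" "AE q in lborel. slice h (fst p) (snd p) q = 0"
          using elim(1,2) by simp_all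
        then show "\<Delta> p = 0" using zero elim(3,4) by (simp add: \<Delta>_def)
      qed
    qed
  qed
  \<comment> \<open>Testing requires vanishing everywhere off \<open>?S\<close>, while \<Delta>
    vanishes there only almost everywhere. The indicator repairs this without changing any integral;
    afterwards it is removed by \<open>vanish\<close>, and \<open>W\<close> never vanishes.\<close>
  have "AE p in frozen_lborel. indicator ?S p *\<^sub>R (W p * \<Delta> p) = 0"
  proof (rule determiningD[OF determining_frozen[OF \<delta>]])
    have "integrable frozen_lborel (\<lambda>p. indicator {p \<in> space frozen_lborel. p \<in> ?S} p *\<^sub>R (W p * \<Delta> p))"
      by (rule integrable_mult_indicator[OF S_sets int0])
    then show "integrable frozen_lborel (\<lambda>p. indicator ?S p *\<^sub>R (W p * \<Delta> p))"
      by (rule Bochner_Integration.integrable_cong[THEN iffD1, rotated -1]) (auto simp: indicator_def)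
    show "indicator ?S p *\<^sub>R (W p * \<Delta> p) = 0" if "p \<notin> ?S" for p using that by simp
    fix e :: "('n \<Rightarrow> real) \<times> ('n \<Rightarrow> real) \<Rightarrow> complex"
    assume "e \<in> {e. \<exists>q \<sigma>. (\<forall>i\<in>?J. 0 < \<sigma> i \<and> \<sigma> i < \<delta>) \<and>
      e = (\<lambda>p. exp (- \<i> * of_real (rest_inner (vec_lambda q) (fst p)) - of_real (rest_inner (vec_lambda \<sigma>) (snd p))))}"
    then obtain q \<sigma> where "\<forall>i\<in>?J. 0 < \<sigma> i \<and> \<sigma> i < \<delta>"
      and e: "e = (\<lambda>p. exp (- \<i> * of_real (rest_inner (vec_lambda q) (fst p)) - of_real (rest_inner (vec_lambda \<sigma>) (snd p))))"
      by blast
    then have \<sigma>: "0 < \<sigma> i \<and> \<sigma> i < \<delta>" if "i \<in> ?J" for i using that by blast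
    have \<sigma>0: "0 \<le> \<sigma> i" if "i \<in> ?J" for i using \<sigma>[OF that] by simp
    let ?k = "(\<chi> i. if i = first then k1 else q i) :: (real, 'n) vec"
    let ?s = "(\<chi> i. if i = first then s1 else \<omega> $ i + \<sigma> i) :: (real, 'n) vec"
    have "(\<Sum>i\<in>?J. \<sigma> i) \<le> real (card ?J) * \<delta>"
      by (rule sum_bounded_above) (use \<sigma> less_imp_le in blast)
    also have "\<dots> < real CARD('n) * \<delta>" using \<delta> by (simp add: card_Diff_singleton)
    also have "\<dots> = s1 - ?w" by (simp add: \<delta>_def)
    finally have "(\<Sum>i\<in>?J. \<sigma> i) < s1 - ?w" .
    moreover have "(\<Sum>i\<in>?J. ?s $ i) = (\<Sum>i\<in>?J. \<omega> $ i) + (\<Sum>i\<in>?J. \<sigma> i)"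
      unfolding sum.distrib[symmetric] by (intro sum.cong) auto
    moreover have "?w = \<omega> $ first + (\<Sum>i\<in>?J. \<omega> $ i)" by (rule sum.remove) auto
    ultimately have gap: "?s $ first - (\<Sum>i\<in>?J. ?s $ i) > \<omega> $ first" by simp
    have "(LINT p|frozen_lborel. e p * (indicator ?S p *\<^sub>R (W p * \<Delta> p))) = (LINT p|frozen_lborel. e p * (W p * \<Delta> p))"
    proof (rule integral_cong_AE)
      show "AE p in frozen_lborel. e p * (indicator ?S p *\<^sub>R (W p * \<Delta> p)) = e p * (W p * \<Delta> p)"
        using vanish by eventually_elim (auto split: split_indicator)
      show m: "(\<lambda>p. e p * (W p * \<Delta> p)) \<in> borel_measurable frozen_lborel"
        unfolding e by (rule borel_measurable_integrable[OF int[OF \<sigma>0]])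
      have "(\<lambda>p. indicator {p \<in> space frozen_lborel. p \<in> ?S} p *\<^sub>R (e p * (W p * \<Delta> p))) \<in> borel_measurable frozen_lborel"
        by (intro borel_measurable_scaleR m borel_measurable_indicator S_sets)
      then show "(\<lambda>p. e p * (indicator ?S p *\<^sub>R (W p * \<Delta> p))) \<in> borel_measurable frozen_lborel"
        by (rule measurable_cong[THEN iffD1, rotated]) (auto simp: indicator_def)
    qed
    also have "\<dots> = \<xi> (- (?k $ first)) (?s $ first) * FL g ?k ?s - FL h ?k ?s"
      unfolding e using lint[OF \<sigma>0] by simp
    also have "\<dots> = 0" using eq[OF _ gap, of ?k] \<sigma> by simp
    finally show "(LINT p|frozen_lborel. e p * (indicator ?S p *\<^sub>R (W p * \<Delta> p))) = 0" .
  qed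
  with vanish show ?thesis
    by eventually_elim (auto simp: \<Delta>_def W_def split: split_indicator_asm)
qed

section \<open>The directional operator\<close>

lemma Xi_B_relI:
  fixes \<omega> :: "real^'n::{finite,wellorder}"
  assumes levy: "levy_subordinator_process M X" and sym: "is_levy_symbol M X \<xi>" and \<omega>: "\<And>i. \<omega> $ i > 0"
    and g: "g \<in> B_space \<omega>" and h: "h \<in> B_space \<omega>"
    and eq: "\<And>k s. \<forall>i. i \<noteq> first \<longrightarrow> s $ i > \<omega> $ i \<Longrightarrow> s $ first - (\<Sum>i\<in>UNIV - {first}. s $ i) > \<omega> $ first \<Longrightarrow>
      \<xi> (- (k $ first)) (s $ first) * FL g k s = FL h k s"
  shows "Xi_B_rel \<xi> \<omega> g h"
proof -
  let ?w = "\<Sum>i\<in>UNIV. \<omega> $ i"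
  \<comment> \<open>Frequencies above \<open>?w\<close> thereby lie in the range of nonnegative
    \<open>s\<close> where \<xi> is tied to the process and its continuity is available.\<close>
  have w: "?w \<ge> 0" using \<omega> by (intro sum_nonneg) (simp add: less_imp_le)
  have "AE p in frozen_lborel. \<forall>q\<in>\<rat> \<times> (\<rat> \<inter> {?w<..}).
      \<xi> (- fst q) (snd q) * FL_half (slice g (fst p) (snd p)) (fst q) (snd q) = FL_half (slice h (fst p) (snd p)) (fst q) (snd q)"
  proof (subst AE_ball_countable)
    show "countable (\<rat> \<times> (\<rat> \<inter> {?w<..}) :: (real \<times> real) set)" by (auto intro: countable_rat)
    show "\<forall>q\<in>\<rat> \<times> (\<rat> \<inter> {?w<..}). AE p in frozen_lborel.
      \<xi> (- fst q) (snd q) * FL_half (slice g (fst p) (snd p)) (fst q) (snd q) = FL_half (slice h (fst p) (snd p)) (fst q) (snd q)"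
      by (intro ballI slices_symbol_eq_zero[OF g h eq]) auto
  qed
  with B_space_slices[OF g] B_space_slices[OF h]
  have "AE (y, r) in frozen_lborel. slice g y r \<in> Xi_dom \<xi> ?w \<and>
      (AE (a, b) in lborel. b \<ge> 0 \<longrightarrow> slice h y r (a, b) = Xi \<xi> ?w (slice g y r) (a, b))"
    unfolding case_prod_beta'
  proof eventually_elim
    case (elim p)
    let ?g = "slice g (fst p) (snd p)" and ?h = "slice h (fst p) (snd p)"
    have "\<xi> (- k) s * FL_half ?g k s = FL_half ?h k s" if s: "s > ?w" for k s
    proof -
      obtain K where K: "\<And>n. K n \<in> \<rat>" "K \<longlonglongrightarrow> k" using rational_approximation by metis
      obtain S where S: "\<And>n. S n \<in> \<rat>" "\<And>n. s < S n" "S \<longlonglongrightarrow> s" using rational_approximation by metis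
      have Sw: "S n \<ge> ?w" "S n \<ge> 0" for n using S(2)[of n] s w by linarith+
      have "(\<lambda>n. \<xi> (- K n) (S n) * FL_half ?g (K n) (S n)) \<longlonglongrightarrow> \<xi> (- k) s * FL_half ?g k s"
        by (intro tendsto_mult levy_symbol_sequentially[OF levy sym] FL_half_sequentially[OF elim(1)]
            tendsto_minus K S Sw)
      moreover have "(\<lambda>n. FL_half ?h (K n) (S n)) \<longlonglongrightarrow> FL_half ?h k s"
        by (intro FL_half_sequentially[OF elim(2)] K S Sw)
      moreover have "\<xi> (- K n) (S n) * FL_half ?g (K n) (S n) = FL_half ?h (K n) (S n)" for n
        using bspec[OF elim(3), of "(K n, S n)"] K(1)[of n] S(1,2)[of n] s by simp
      ultimately show ?thesis using LIMSEQ_unique by simp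
    qed
    then have rel: "Xi_rel \<xi> ?w ?g ?h" using elim by (simp add: Xi_rel_def)
    then have Xi: "Xi_rel \<xi> ?w ?g (Xi \<xi> ?w ?g)" unfolding Xi_def by (rule someI[of "Xi_rel \<xi> ?w ?g"])
    \<comment> \<open>Both functions solve the same one-dimensional equation, so their transforms
      agree and injectivity identifies them.\<close>
    have "AE (a, b) in lborel. b \<ge> 0 \<longrightarrow> ?h (a, b) = Xi \<xi> ?w ?g (a, b)"
      by (rule FL_half_unique) (use rel Xi in \<open>auto simp: Xi_rel_def\<close>)
    moreover have "?g \<in> Xi_dom \<xi> ?w" using elim rel by (auto simp: Xi_dom_def)
    ultimately show ?case by (simp add: case_prod_beta')
  qed
  then show ?thesis unfolding Xi_B_rel_def frozen_lborel_def using h by blast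
qed

theorem proposition2:
  fixes M :: "'a measure" and X :: "real \<Rightarrow> 'a \<Rightarrow> real \<times> real"
    and \<xi> :: "real \<Rightarrow> real \<Rightarrow> complex"
    and \<omega> :: "real^'n::{finite,wellorder}"
  assumes "levy_subordinator_process M X"
    and "is_levy_symbol M X \<xi>"
    and "\<And>i. \<omega> $ i > 0"
  shows "(\<forall>f \<in> Xi_A_dom \<xi> \<omega>. \<forall>k. \<forall>s \<in> A_hat \<omega>.
            FL (Xi_A \<xi> \<omega> f) k s
              = \<xi> (- (\<Sum>i\<in>UNIV. k $ i)) (\<Sum>i\<in>UNIV. s $ i) * FL f k s) \<and>
         Xi_A_dom \<xi> \<omega> =
           {f \<in> A_space \<omega>. \<exists>h \<in> A_space \<omega>. \<forall>k. \<forall>s \<in> A_hat \<omega>.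
              \<xi> (- (\<Sum>i\<in>UNIV. k $ i)) (\<Sum>i\<in>UNIV. s $ i) * FL f k s = FL h k s}"
proof -
  have A_L1: "f \<in> L1 \<omega>" if "f \<in> A_space \<omega>" for f using that by (simp add: A_space_def)
  have symbol: "Xi_A \<xi> \<omega> f \<in> A_space \<omega> \<and> (\<forall>k. \<forall>s \<in> A_hat \<omega>.
      FL (Xi_A \<xi> \<omega> f) k s = \<xi> (- (\<Sum>i\<in>UNIV. k $ i)) (\<Sum>i\<in>UNIV. s $ i) * FL f k s)"
    if f: "f \<in> Xi_A_dom \<xi> \<omega>" for f
  proof -
    have fA: "f \<in> A_space \<omega>" and ex: "\<exists>h. Xi_B_rel \<xi> \<omega> (T_op f) h"
      using f by (auto simp: Xi_A_dom_def Xi_B_dom_def)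
    have rel: "Xi_B_rel \<xi> \<omega> (T_op f) (Xi_B \<xi> \<omega> (T_op f))"
      using ex unfolding Xi_B_def by (rule someI_ex)
    then have A: "Xi_A \<xi> \<omega> f \<in> A_space \<omega>"
      unfolding Xi_A_def by (intro T_inv_op_A_space) (simp add: Xi_B_rel_def)
    have "FL (Xi_A \<xi> \<omega> f) k s = \<xi> (- (\<Sum>i\<in>UNIV. k $ i)) (\<Sum>i\<in>UNIV. s $ i) * FL f k s"
      if s: "s \<in> A_hat \<omega>" for k s
    proof -
      \<comment> \<open>The change of variables is applied to \<open>Xi_A \<xi> \<omega> f\<close>,
        whose image under \<open>T_op\<close> is the value of the operator on the cone B.\<close>
      have "FL (Xi_A \<xi> \<omega> f) k s = FL (Xi_B \<xi> \<omega> (T_op f)) (transpose T_mat *v k) (transpose T_mat *v s)"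
        using FL_T_op[OF A_L1[OF A], of k s] by (simp only: Xi_A_def T_op_T_inv_op)
      also have "\<dots> = \<xi> (- ((transpose T_mat *v k) $ first)) ((transpose T_mat *v s) $ first)
          * FL (T_op f) (transpose T_mat *v k) (transpose T_mat *v s)"
        by (rule Xi_B_rel_FL[OF rel T_op_B_space[OF fA] A_hat_transpose_T_mat[OF s]])
      also have "\<dots> = \<xi> (- (\<Sum>i\<in>UNIV. k $ i)) (\<Sum>i\<in>UNIV. s $ i) * FL f k s"
        unfolding FL_T_op[OF A_L1[OF fA]] by (simp add: transpose_T_mat_mult_nth)
      finally show ?thesis .
    qed
    with A show ?thesis by blast
  qed
  have converse: "f \<in> Xi_A_dom \<xi> \<omega>"
    if f: "f \<in> A_space \<omega>" and h: "h \<in> A_space \<omega>"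
      and eq: "\<forall>k. \<forall>s \<in> A_hat \<omega>. \<xi> (- (\<Sum>i\<in>UNIV. k $ i)) (\<Sum>i\<in>UNIV. s $ i) * FL f k s = FL h k s" for f h
  proof -
    have "Xi_B_rel \<xi> \<omega> (T_op f) (T_op h)"
    proof (rule Xi_B_relI[OF assms T_op_B_space[OF f] T_op_B_space[OF h]])
      fix k s :: "(real, 'n) vec"
      assume s: "\<forall>i. i \<noteq> first \<longrightarrow> s $ i > \<omega> $ i" "s $ first - (\<Sum>i\<in>UNIV - {first}. s $ i) > \<omega> $ first"
      \<comment> \<open>These are the preimages under the transposed matrix; the two conditions on
        \<open>s\<close> say exactly that \<open>s'\<close> lies in
        \<open>A_hat \<omega>\<close>.\<close>
      define k' s' :: "(real, 'n) vec"
        where "k' = (\<chi> i. if i = first then k $ first - (\<Sum>j\<in>UNIV - {first}. k $ j) else k $ i)"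
          and "s' = (\<chi> i. if i = first then s $ first - (\<Sum>j\<in>UNIV - {first}. s $ j) else s $ i)"
      have "s' \<in> A_hat \<omega>" using s by (auto simp: A_hat_def s'_def)
      then have "\<xi> (- (\<Sum>i\<in>UNIV. k' $ i)) (\<Sum>i\<in>UNIV. s' $ i) * FL f k' s' = FL h k' s'" using eq by blast
      then show "\<xi> (- (k $ first)) (s $ first) * FL (T_op f) k s = FL (T_op h) k s"
        using FL_T_op[OF A_L1[OF f], of k' s'] FL_T_op[OF A_L1[OF h], of k' s']
        by (simp only: k'_def s'_def transpose_T_mat_preimage)
    qed
    then show ?thesis using f T_op_B_space[OF f] by (auto simp: Xi_A_dom_def Xi_B_dom_def)
  qed
  show ?thesis
  proof (intro conjI equalityI subsetI)
    show "\<forall>f \<in> Xi_A_dom \<xi> \<omega>. \<forall>k. \<forall>s \<in> A_hat \<omega>.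
        FL (Xi_A \<xi> \<omega> f) k s = \<xi> (- (\<Sum>i\<in>UNIV. k $ i)) (\<Sum>i\<in>UNIV. s $ i) * FL f k s"
      using symbol by blast
  next
    fix f assume f: "f \<in> Xi_A_dom \<xi> \<omega>"
    then have "f \<in> A_space \<omega>" by (simp add: Xi_A_dom_def)
    moreover have "\<exists>h \<in> A_space \<omega>. \<forall>k. \<forall>s \<in> A_hat \<omega>.
        \<xi> (- (\<Sum>i\<in>UNIV. k $ i)) (\<Sum>i\<in>UNIV. s $ i) * FL f k s = FL h k s"
      \<comment> \<open>The value of the operator is the witness for h: it lies in
        \<open>A_space \<omega>\<close>, and the symbol formula is the required equation.\<close>
      by (rule bexI[of _ "Xi_A \<xi> \<omega> f"]) (use symbol[OF f] in simp_all)
    ultimately show "f \<in> {f \<in> A_space \<omega>. \<exists>h \<in> A_space \<omega>. \<forall>k. \<forall>s \<in> A_hat \<omega>.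
        \<xi> (- (\<Sum>i\<in>UNIV. k $ i)) (\<Sum>i\<in>UNIV. s $ i) * FL f k s = FL h k s}"
      by blast
  next
    fix f assume "f \<in> {f \<in> A_space \<omega>. \<exists>h \<in> A_space \<omega>. \<forall>k. \<forall>s \<in> A_hat \<omega>.
        \<xi> (- (\<Sum>i\<in>UNIV. k $ i)) (\<Sum>i\<in>UNIV. s $ i) * FL f k s = FL h k s}"
    then show "f \<in> Xi_A_dom \<xi> \<omega>" using converse by blast
  qed
qed

end
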